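(* Let $T$ be a complete decidable theory in a computable language and let $\mathcal{A} \models T$ be a decidable model. Then either there is a computable function $h$ witnessing that $\mathcal{A}$ is effectively atomic, or there is a decidable model $\mathcal{M} \models T$ such that there is no computable elementary embedding of $\mathcal{A}$ into $\mathcal{M}$.
   Context: A structure is decidable if its complete (elementary) diagram is computable. A formula $\varphi(\vec{x})$ is complete (relative to $T$) if for every formula $\psi(\vec{x})$ exactly one of $T \vdash \varphi(\vec{x}) \rightarrow \psi(\vec{x})$ or $T \vdash \varphi(\vec{x}) \rightarrow \neg\psi(\vec{x})$ holds. A computable function $h$ witnesses that $\mathcal{A}$ is effectively atomic if, given any finite tuple $\vec{a}$ of elements of $\mathcal{A}$ (of any length), $h(\vec{a})$ is a complete formula $\varphi(\vec{x})$ with $\mathcal{A} \models \varphi(\vec{a})$. *)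

theory Defs
  imports Main "HOL-Library.Nat_Bijection"
begin

section \<open>Computability\<close>

text \<open>Unbounded search: undefined as soon as a value below the first zero is undefined.\<close>

definition mu :: "(nat \<Rightarrow> nat option) \<Rightarrow> nat option" where
  "mu f = (if \<exists>n. f n = Some 0 \<and> (\<forall>m<n. f m \<noteq> None)
           then Some (LEAST n. f n = Some 0) else None)"

text \<open>The partial recursive functions, in unary form: several arguments are passed as one
  number by means of Cantor pairing.\<close>

inductive partial_recursive :: "(nat \<Rightarrow> nat option) \<Rightarrow> bool" where
  Zero: "partial_recursive (\<lambda>_. Some 0)"
| Succ: "partial_recursive (\<lambda>n. Some (Suc n))"
| Left: "partial_recursive (\<lambda>n. Some (fst (prod_decode n)))"
| Right: "partial_recursive (\<lambda>n. Some (snd (prod_decode n)))"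
| Pair: "partial_recursive f \<Longrightarrow> partial_recursive g \<Longrightarrow>
    partial_recursive
      (\<lambda>n. Option.bind (f n) (\<lambda>a. Option.bind (g n) (\<lambda>b. Some (prod_encode (a, b)))))"
| Comp: "partial_recursive f \<Longrightarrow> partial_recursive g \<Longrightarrow>
    partial_recursive (\<lambda>n. Option.bind (g n) f)"
| Prec: "partial_recursive f \<Longrightarrow> partial_recursive g \<Longrightarrow>
    partial_recursive (\<lambda>n. case prod_decode n of (a, k) \<Rightarrow>
      rec_nat (f a)
        (\<lambda>i r. Option.bind r (\<lambda>v. g (prod_encode (a, prod_encode (i, v))))) k)"
| Mu: "partial_recursive f \<Longrightarrow> partial_recursive (\<lambda>a. mu (\<lambda>n. f (prod_encode (a, n))))"

definition computable :: "(nat \<Rightarrow> nat) \<Rightarrow> bool" where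
  "computable f \<longleftrightarrow> partial_recursive (\<lambda>n. Some (f n))"

definition computable_set :: "nat set \<Rightarrow> bool" where
  "computable_set S \<longleftrightarrow> computable (\<lambda>n. if n \<in> S then 1 else 0)"

definition computable_via :: "('a \<Rightarrow> nat) \<Rightarrow> ('b \<Rightarrow> nat) \<Rightarrow> ('a \<Rightarrow> 'b) \<Rightarrow> bool" where
  "computable_via c d h \<longleftrightarrow> (\<exists>g. computable g \<and> (\<forall>x. g (c x) = d (h x)))"


section \<open>First-order syntax\<close>

text \<open>Symbols are natural numbers; a number with arity \<open>None\<close> is not a symbol of the language.
  Constants are function symbols of arity 0.\<close>

record lang =
  fun_arity :: "nat \<Rightarrow> nat option"
  rel_arity :: "nat \<Rightarrow> nat option"

definition computable_language :: "lang \<Rightarrow> bool" where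
  "computable_language L \<longleftrightarrow>
     computable (\<lambda>f. case fun_arity L f of None \<Rightarrow> 0 | Some k \<Rightarrow> Suc k) \<and>
     computable (\<lambda>r. case rel_arity L r of None \<Rightarrow> 0 | Some k \<Rightarrow> Suc k)"

datatype tm = Var nat | Fn nat "tm list"

text \<open>Variables are de Bruijn indices; the quantifier \<open>All\<close> binds index 0.\<close>

datatype fm = Eq tm tm | Rel nat "tm list" | Neg fm | Imp fm fm | All fm

fun wf_tm :: "lang \<Rightarrow> tm \<Rightarrow> bool" where
  "wf_tm L (Var n) \<longleftrightarrow> True"
| "wf_tm L (Fn f ts) \<longleftrightarrow> fun_arity L f = Some (length ts) \<and> (\<forall>t\<in>set ts. wf_tm L t)"

fun wf_fm :: "lang \<Rightarrow> fm \<Rightarrow> bool" where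
  "wf_fm L (Eq s t) \<longleftrightarrow> wf_tm L s \<and> wf_tm L t"
| "wf_fm L (Rel r ts) \<longleftrightarrow> rel_arity L r = Some (length ts) \<and> (\<forall>t\<in>set ts. wf_tm L t)"
| "wf_fm L (Neg p) \<longleftrightarrow> wf_fm L p"
| "wf_fm L (Imp p q) \<longleftrightarrow> wf_fm L p \<and> wf_fm L q"
| "wf_fm L (All p) \<longleftrightarrow> wf_fm L p"

fun fv_tm :: "tm \<Rightarrow> nat set" where
  "fv_tm (Var n) = {n}"
| "fv_tm (Fn f ts) = (\<Union>t\<in>set ts. fv_tm t)"

fun fv_fm :: "fm \<Rightarrow> nat set" where
  "fv_fm (Eq s t) = fv_tm s \<union> fv_tm t"
| "fv_fm (Rel r ts) = (\<Union>t\<in>set ts. fv_tm t)"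
| "fv_fm (Neg p) = fv_fm p"
| "fv_fm (Imp p q) = fv_fm p \<union> fv_fm q"
| "fv_fm (All p) = {n. Suc n \<in> fv_fm p}"

text \<open>The formulas \<open>\<phi>(x\<^sub>0, \<dots>, x\<^sub>n\<^sub>-\<^sub>1)\<close>.\<close>

definition formulas :: "lang \<Rightarrow> nat \<Rightarrow> fm set" where
  "formulas L n = {p. wf_fm L p \<and> fv_fm p \<subseteq> {..<n}}"

abbreviation sentences :: "lang \<Rightarrow> fm set" where
  "sentences L \<equiv> formulas L 0"

fun tm_code :: "tm \<Rightarrow> nat" where
  "tm_code (Var n) = prod_encode (0, n)"
| "tm_code (Fn f ts) = prod_encode (1, prod_encode (f, list_encode (map tm_code ts)))"

fun fm_code :: "fm \<Rightarrow> nat" where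
  "fm_code (Eq s t) = prod_encode (0, prod_encode (tm_code s, tm_code t))"
| "fm_code (Rel r ts) = prod_encode (1, prod_encode (r, list_encode (map tm_code ts)))"
| "fm_code (Neg p) = prod_encode (2, fm_code p)"
| "fm_code (Imp p q) = prod_encode (3, prod_encode (fm_code p, fm_code q))"
| "fm_code (All p) = prod_encode (4, fm_code p)"


section \<open>Derivability\<close>

fun subst_tm :: "(nat \<Rightarrow> tm) \<Rightarrow> tm \<Rightarrow> tm" where
  "subst_tm s (Var n) = s n"
| "subst_tm s (Fn f ts) = Fn f (map (subst_tm s) ts)"

definition shift :: "nat \<Rightarrow> tm" where
  "shift n = Var (Suc n)"

fun subst_fm :: "(nat \<Rightarrow> tm) \<Rightarrow> fm \<Rightarrow> fm" where
  "subst_fm s (Eq t u) = Eq (subst_tm s t) (subst_tm s u)"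
| "subst_fm s (Rel r ts) = Rel r (map (subst_tm s) ts)"
| "subst_fm s (Neg p) = Neg (subst_fm s p)"
| "subst_fm s (Imp p q) = Imp (subst_fm s p) (subst_fm s q)"
| "subst_fm s (All p) = All (subst_fm (case_nat (Var 0) (\<lambda>n. subst_tm shift (s n))) p)"

definition inst :: "tm \<Rightarrow> fm \<Rightarrow> fm" where
  "inst t p = subst_fm (case_nat t Var) p"

text \<open>A Hilbert calculus for first-order logic with equality. Generalisation is unrestricted, so
  an open formula is derivable from a set of sentences iff its universal closure is.\<close>

inductive derives :: "lang \<Rightarrow> fm set \<Rightarrow> fm \<Rightarrow> bool" for L T where
  Ax: "p \<in> T \<Longrightarrow> wf_fm L p \<Longrightarrow> derives L T p"
| K: "wf_fm L p \<Longrightarrow> wf_fm L q \<Longrightarrow> derives L T (Imp p (Imp q p))"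
| S: "wf_fm L p \<Longrightarrow> wf_fm L q \<Longrightarrow> wf_fm L r \<Longrightarrow>
    derives L T (Imp (Imp p (Imp q r)) (Imp (Imp p q) (Imp p r)))"
| Contra: "wf_fm L p \<Longrightarrow> wf_fm L q \<Longrightarrow>
    derives L T (Imp (Imp (Neg p) (Neg q)) (Imp q p))"
| All_inst: "wf_fm L p \<Longrightarrow> wf_tm L t \<Longrightarrow> derives L T (Imp (All p) (inst t p))"
| All_Imp: "wf_fm L p \<Longrightarrow> wf_fm L q \<Longrightarrow>
    derives L T (Imp (All (Imp p q)) (Imp (All p) (All q)))"
| All_vacuous: "wf_fm L p \<Longrightarrow> derives L T (Imp p (All (subst_fm shift p)))"
| Eq_refl: "wf_tm L t \<Longrightarrow> derives L T (Eq t t)"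
| Eq_subst: "wf_tm L t \<Longrightarrow> wf_tm L u \<Longrightarrow> wf_fm L p \<Longrightarrow>
    derives L T (Imp (Eq t u) (Imp (inst t p) (inst u p)))"
| MP: "derives L T (Imp p q) \<Longrightarrow> derives L T p \<Longrightarrow> derives L T q"
| Gen: "derives L T p \<Longrightarrow> derives L T (All p)"

definition complete_theory :: "lang \<Rightarrow> fm set \<Rightarrow> bool" where
  "complete_theory L T \<longleftrightarrow> T \<subseteq> sentences L \<and>
     (\<forall>p\<in>sentences L. derives L T p \<or> derives L T (Neg p))"

text \<open>\<open>T\<close> need not be deductively closed, so decidability refers to its set of theorems.\<close>

definition decidable_theory :: "lang \<Rightarrow> fm set \<Rightarrow> bool" where
  "decidable_theory L T \<longleftrightarrow> computable_set (fm_code ` {p \<in> sentences L. derives L T p})"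

definition complete_formula :: "lang \<Rightarrow> fm set \<Rightarrow> nat \<Rightarrow> fm \<Rightarrow> bool" where
  "complete_formula L T n p \<longleftrightarrow> p \<in> formulas L n \<and>
     (\<forall>q\<in>formulas L n. derives L T (Imp p q) \<noteq> derives L T (Imp p (Neg q)))"


section \<open>Structures\<close>

record 'a struct =
  univ :: "'a set"
  fun_interp :: "nat \<Rightarrow> 'a list \<Rightarrow> 'a"
  rel_interp :: "nat \<Rightarrow> 'a list \<Rightarrow> bool"

definition is_structure :: "lang \<Rightarrow> 'a struct \<Rightarrow> bool" where
  "is_structure L A \<longleftrightarrow> univ A \<noteq> {} \<and>
     (\<forall>f as. fun_arity L f = Some (length as) \<longrightarrow> set as \<subseteq> univ A \<longrightarrow>
        fun_interp A f as \<in> univ A)"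

fun eval :: "'a struct \<Rightarrow> (nat \<Rightarrow> 'a) \<Rightarrow> tm \<Rightarrow> 'a" where
  "eval A e (Var n) = e n"
| "eval A e (Fn f ts) = fun_interp A f (map (eval A e) ts)"

fun sat :: "'a struct \<Rightarrow> (nat \<Rightarrow> 'a) \<Rightarrow> fm \<Rightarrow> bool" where
  "sat A e (Eq s t) \<longleftrightarrow> eval A e s = eval A e t"
| "sat A e (Rel r ts) \<longleftrightarrow> rel_interp A r (map (eval A e) ts)"
| "sat A e (Neg p) \<longleftrightarrow> \<not> sat A e p"
| "sat A e (Imp p q) \<longleftrightarrow> (sat A e p \<longrightarrow> sat A e q)"
| "sat A e (All p) \<longleftrightarrow> (\<forall>d\<in>univ A. sat A (case_nat d e) p)"

text \<open>\<open>holds A p as\<close> is meant for \<open>p \<in> formulas L (length as)\<close>; the values of \<open>nth as\<close>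
  beyond the length of \<open>as\<close> are then irrelevant.\<close>

definition holds :: "'a struct \<Rightarrow> fm \<Rightarrow> 'a list \<Rightarrow> bool" where
  "holds A p as \<longleftrightarrow> sat A (nth as) p"

definition is_model :: "lang \<Rightarrow> 'a struct \<Rightarrow> fm set \<Rightarrow> bool" where
  "is_model L A T \<longleftrightarrow> is_structure L A \<and> (\<forall>p\<in>T. holds A p [])"

text \<open>A sentence \<open>\<phi>(a\<^sub>0, \<dots>, a\<^sub>n\<^sub>-\<^sub>1)\<close> of the elementary diagram is represented by the pair of
  \<open>\<phi>\<close> and the tuple of its parameters. Computability of the diagram entails computability of
  the universe, via the formula \<open>x\<^sub>0 = x\<^sub>0\<close>.\<close>

definition elementary_diagram :: "lang \<Rightarrow> 'a struct \<Rightarrow> (fm \<times> 'a list) set" where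
  "elementary_diagram L A =
     {(p, as). set as \<subseteq> univ A \<and> p \<in> formulas L (length as) \<and> holds A p as}"

definition decidable_structure :: "lang \<Rightarrow> nat struct \<Rightarrow> bool" where
  "decidable_structure L A \<longleftrightarrow>
     computable_set ((\<lambda>(p, as). prod_encode (fm_code p, list_encode as)) ` elementary_diagram L A)"

definition elementary_embedding :: "lang \<Rightarrow> 'a struct \<Rightarrow> 'b struct \<Rightarrow> ('a \<Rightarrow> 'b) \<Rightarrow> bool" where
  "elementary_embedding L A M f \<longleftrightarrow> f ` univ A \<subseteq> univ M \<and>
     (\<forall>as. set as \<subseteq> univ A \<longrightarrow>
        (\<forall>p\<in>formulas L (length as). holds A p as \<longleftrightarrow> holds M p (map f as)))"

text \<open>\<open>h\<close>, like a computable embedding, is a total function with arbitrary values off the universe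
  of \<open>A\<close>; this is no restriction, since the universe of a decidable structure is computable.\<close>

definition witnesses_effectively_atomic ::
    "lang \<Rightarrow> fm set \<Rightarrow> nat struct \<Rightarrow> (nat list \<Rightarrow> fm) \<Rightarrow> bool" where
  "witnesses_effectively_atomic L T A h \<longleftrightarrow> computable_via list_encode fm_code h \<and>
     (\<forall>as. set as \<subseteq> univ A \<longrightarrow> complete_formula L T (length as) (h as) \<and> holds A (h as) as)"

end

theory Submission imports Defs begin

text \<open>The model \<open>M\<close> is built by a Henkin construction whose constants are the variables: \<open>stage s\<close> is a
  formula realized in \<open>A\<close>, i.e. consistent with \<open>T\<close>, that gets stronger with \<open>s\<close>. Requirement \<open>e\<close> wants to
  prevent the \<open>e\<close>-th partial recursive function from embedding \<open>A\<close> into \<open>M\<close>. Whenever a formula \<open>\<tau>\<close> is about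
  to be added, requirement \<open>e\<close> looks at the finitely many values \<open>b = \<phi>\<^sub>e(a)\<close> computed so far and at the
  formula \<open>\<chi>(x) = \<exists>y. (stage s \<and> \<tau>)(x, y)\<close>, where \<open>x\<close> stands for the constants \<open>b\<close>. If \<open>A\<close> satisfies \<open>\<chi>(a)\<close>
  while \<open>\<not> \<chi>(b)\<close> is consistent with \<open>stage s\<close>, it adds \<open>\<not> \<chi>(b)\<close> instead of \<open>\<tau>\<close> and is satisfied for ever,
  unless a stronger requirement overrules it. So every requirement prevails at most once.

  If nevertheless \<open>f = \<phi>\<^sub>e\<close> is an elementary embedding, then after some stage \<open>s\<^sub>0\<close> nothing that is added
  strengthens what \<open>stage s\<close> says about the values \<open>f a\<close> known at stage \<open>s\<close>. Hence \<open>\<exists>y. stage s (x, y)\<close>, with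
  \<open>x\<close> for the constants \<open>f a\<close> and \<open>s \<ge> s\<^sub>0\<close> so large that \<open>f a\<close> has been computed, is a complete formula
  satisfied by \<open>a\<close>, and it is found computably from \<open>a\<close>.\<close>

section \<open>Closure properties of the computable functions\<close>

named_theorems computable_intros

definition pfst :: "nat \<Rightarrow> nat" where "pfst n = fst (prod_decode n)"
definition psnd :: "nat \<Rightarrow> nat" where "psnd n = snd (prod_decode n)"

lemma pfst_encode [simp]: "pfst (prod_encode (a, b)) = a" by (simp add: pfst_def)
lemma psnd_encode [simp]: "psnd (prod_encode (a, b)) = b" by (simp add: psnd_def)
lemma prod_encode_pfst_psnd [simp]: "prod_encode (pfst n, psnd n) = n"
  by (simp add: pfst_def psnd_def)

definition computable_pred :: "(nat \<Rightarrow> bool) \<Rightarrow> bool" where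
  "computable_pred P \<longleftrightarrow> computable (\<lambda>x. if P x then 1 else 0)"

lemma computable_comp:
  assumes "computable f" "computable g" shows "computable (\<lambda>x. f (g x))"
  using partial_recursive.Comp[OF assms[unfolded computable_def]] by (simp add: computable_def)

lemma computable_zero: "computable (\<lambda>_. 0)"
  by (simp add: computable_def partial_recursive.Zero)

lemma computable_Suc [computable_intros]: "computable f \<Longrightarrow> computable (\<lambda>x. Suc (f x))"
  using computable_comp[of Suc f] by (simp add: computable_def partial_recursive.Succ)

lemma computable_const [computable_intros]: "computable (\<lambda>_. c)"
  by (induction c) (auto intro: computable_zero computable_Suc)

lemma computable_pfst [computable_intros]: "computable f \<Longrightarrow> computable (\<lambda>x. pfst (f x))"
  using computable_comp[of pfst f] partial_recursive.Left by (simp add: computable_def pfst_def)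

lemma computable_psnd [computable_intros]: "computable f \<Longrightarrow> computable (\<lambda>x. psnd (f x))"
  using computable_comp[of psnd f] partial_recursive.Right by (simp add: computable_def psnd_def)

lemma computable_pair [computable_intros]:
  "computable f \<Longrightarrow> computable g \<Longrightarrow> computable (\<lambda>x. prod_encode (f x, g x))"
  unfolding computable_def by (drule (1) partial_recursive.Pair) simp

text \<open>The identity is not among the basic functions; it arises as the pairing of the two
  projections.\<close>

lemma computable_id [computable_intros]: "computable (\<lambda>x. x)"
  using computable_pair[OF computable_pfst computable_psnd]
    partial_recursive.Left partial_recursive.Right
    partial_recursive.Pair[OF partial_recursive.Left partial_recursive.Right]
  by (simp add: computable_def)

text \<open>A function of two arguments is treated as a function of the pair \<open>z\<close>. The
  rules for recursion, bounded quantifiers and search state their premises about bound variables in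
  this form.\<close>

lemma computable_comp2:
  assumes "computable (\<lambda>z. g (pfst z) (psnd z))" "computable u" "computable v"
  shows "computable (\<lambda>x. g (u x) (v x))"
  using computable_comp[OF assms(1) computable_pair[OF assms(2,3)]] by simp

text \<open>Under a bound variable the former argument becomes the first component of a pair; this
  rule carries computability over to that situation.\<close>

lemma computable_comp_pfst:
  "computable f \<Longrightarrow> computable u \<Longrightarrow> computable (\<lambda>z. f (pfst (u z)))"
  by (erule computable_comp) (rule computable_pfst)

lemma computable_rec [computable_intros]:
  assumes "computable f" "computable k"
    and "computable (\<lambda>z. g (pfst z) (pfst (psnd z)) (psnd (psnd z)))"
  shows "computable (\<lambda>x. rec_nat (f x) (g x) (k x))"
proof -
  have *: "rec_nat (Some (f a)) (\<lambda>i r. Option.bind r (\<lambda>v. Some (g a i v))) n = Some (rec_nat (f a) (g a) n)"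
    for a n by (induction n) auto
  have "computable (\<lambda>z. rec_nat (f (pfst z)) (g (pfst z)) (psnd z))"
    using partial_recursive.Prec[OF assms(1,3)[unfolded computable_def]]
    by (simp add: computable_def * split_beta flip: pfst_def psnd_def)
  from computable_comp[OF this computable_pair[OF computable_id assms(2)]] show ?thesis by simp
qed

lemma computable_case_nat [computable_intros]:
  assumes "computable f" "computable k" and "computable (\<lambda>z. g (pfst z) (psnd z))"
  shows "computable (\<lambda>x. case k x of 0 \<Rightarrow> f x | Suc i \<Rightarrow> g x i)"
proof -
  have "(case k x of 0 \<Rightarrow> f x | Suc i \<Rightarrow> g x i) = rec_nat (f x) (\<lambda>i _. g x i) (k x)" for x
    by (cases "k x") auto
  moreover have "computable (\<lambda>z. g (pfst z) (pfst (psnd z)))"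
    by (intro computable_comp2[OF assms(3)] computable_intros)
  ultimately show ?thesis using computable_rec[OF assms(1,2), of "\<lambda>x i _. g x i"] by (simp only:)
qed

lemma computable_add [computable_intros]:
  assumes "computable f" "computable g" shows "computable (\<lambda>x. f x + g x)"
proof -
  have *: "m + n = rec_nat m (\<lambda>_ r. Suc r) n" for m n :: nat by (induction n) auto
  show ?thesis unfolding * by (intro computable_intros assms)
qed

lemma computable_pred1: "computable f \<Longrightarrow> computable (\<lambda>x. f x - 1)"
proof -
  assume "computable f"
  moreover have "f x - 1 = (case f x of 0 \<Rightarrow> 0 | Suc i \<Rightarrow> i)" for x by (auto split: nat.split)
  ultimately show ?thesis by (simp only:) (intro computable_intros)
qed

lemma computable_diff [computable_intros]:
  assumes "computable f" "computable g" shows "computable (\<lambda>x. f x - g x)"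
proof -
  have *: "m - n = rec_nat m (\<lambda>_ r. r - 1) n" for m n :: nat by (induction n) auto
  have eq: "(\<lambda>x. f x - g x) = (\<lambda>x. rec_nat (f x) (\<lambda>_ r. r - 1) (g x))" by (rule ext, rule *)
  show ?thesis unfolding eq by (intro computable_intros assms computable_pred1)
qed

lemma computable_if [computable_intros]:
  assumes "computable_pred P" "computable f" "computable g"
  shows "computable (\<lambda>x. if P x then f x else g x)"
proof -
  have eq: "(\<lambda>x. if P x then f x else g x) =
      (\<lambda>x. case (if P x then 1 else 0) of 0 \<Rightarrow> g x | Suc _ \<Rightarrow> f x)"
    by auto
  have "computable (\<lambda>z. f (pfst z))"
    by (intro computable_comp[OF assms(2)] computable_intros)
  then show ?thesis unfolding eq
    by (rule computable_case_nat[OF assms(3) assms(1)[unfolded computable_pred_def]])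
qed

lemma computable_pred_const [computable_intros]: "computable_pred (\<lambda>_. b)"
  unfolding computable_pred_def by (rule computable_const)

lemma computable_pred_comp: "computable_pred P \<Longrightarrow> computable f \<Longrightarrow> computable_pred (\<lambda>x. P (f x))"
  unfolding computable_pred_def by (rule computable_comp)

lemma computable_pred_not [computable_intros]: "computable_pred P \<Longrightarrow> computable_pred (\<lambda>x. \<not> P x)"
proof -
  assume "computable_pred P"
  then have "computable (\<lambda>x. if P x then 0 else 1)" by (intro computable_intros)
  moreover have "(if P x then 0 else 1) = (if \<not> P x then 1 else 0 :: nat)" for x by simp
  ultimately show ?thesis by (simp only: computable_pred_def)
qed

lemma computable_pred_comp2:
  assumes "computable_pred (\<lambda>z. P (pfst z) (psnd z))" "computable u" "computable v"
  shows "computable_pred (\<lambda>x. P (u x) (v x))"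
  using computable_pred_comp[OF assms(1) computable_pair[OF assms(2,3)]] by simp

lemma computable_pred_conj [computable_intros]:
  assumes "computable_pred P" "computable_pred Q" shows "computable_pred (\<lambda>x. P x \<and> Q x)"
proof -
  have "(if P x \<and> Q x then 1 else 0 :: nat) = (if P x then if Q x then 1 else 0 else 0)" for x by auto
  then show ?thesis using assms unfolding computable_pred_def[of "\<lambda>x. P x \<and> Q x"]
    by (simp only:) (intro computable_intros)
qed

lemma computable_pred_disj [computable_intros]:
  assumes "computable_pred P" "computable_pred Q" shows "computable_pred (\<lambda>x. P x \<or> Q x)"
proof -
  have "(\<lambda>x. P x \<or> Q x) = (\<lambda>x. \<not> (\<not> P x \<and> \<not> Q x))" by auto
  then show ?thesis using assms by (simp only:) (intro computable_intros)
qed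

lemma computable_pred_imp [computable_intros]:
  assumes "computable_pred P" "computable_pred Q" shows "computable_pred (\<lambda>x. P x \<longrightarrow> Q x)"
proof -
  have "(\<lambda>x. P x \<longrightarrow> Q x) = (\<lambda>x. \<not> P x \<or> Q x)" by auto
  then show ?thesis using assms by (simp only:) (intro computable_intros)
qed

lemma computable_pred_less [computable_intros]:
  assumes "computable f" "computable g" shows "computable_pred (\<lambda>x. f x < g x)"
proof -
  have "(if f x < g x then 1 else 0 :: nat) = (case g x - f x of 0 \<Rightarrow> 0 | Suc _ \<Rightarrow> 1)" for x
    by (auto split: nat.split)
  then show ?thesis unfolding computable_pred_def by (simp only:) (intro computable_intros assms)
qed

lemma computable_pred_eq [computable_intros]:
  assumes "computable f" "computable g" shows "computable_pred (\<lambda>x. f x = g x)"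
proof -
  have "(\<lambda>x. f x = g x) = (\<lambda>x. \<not> f x < g x \<and> \<not> g x < f x)" by auto
  then show ?thesis using assms by (simp only:) (intro computable_intros)
qed

lemma computable_pred_le [computable_intros]:
  assumes "computable f" "computable g" shows "computable_pred (\<lambda>x. f x \<le> g x)"
  using computable_pred_not[OF computable_pred_less[OF assms(2,1)]] by (simp add: not_less)

lemma computable_pred_bex [computable_intros]:
  assumes "computable b" "computable_pred (\<lambda>z. P (pfst z) (psnd z))"
  shows "computable_pred (\<lambda>x. \<exists>i<b x. P x i)"
proof -
  have *: "(if \<exists>i<n. P x i then 1 else 0 :: nat) = rec_nat 0 (\<lambda>i r. if P x i then 1 else r) n" for x n
  proof (induction n)
    case (Suc n)
    then show ?case unfolding nat.rec(2) Suc.IH[symmetric] by (simp add: less_Suc_eq ex_disj_distrib conj_disj_distribR)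
  qed simp
  have "computable_pred (\<lambda>z. P (pfst z) (pfst (psnd z)))"
    by (intro computable_pred_comp2[OF assms(2)] computable_intros)
  then have "computable (\<lambda>x. rec_nat 0 (\<lambda>i r. if P x i then 1 else r) (b x))"
    by (intro computable_intros assms)
  then show ?thesis by (simp only: computable_pred_def *)
qed

lemma computable_pred_ball [computable_intros]:
  assumes "computable b" "computable_pred (\<lambda>z. P (pfst z) (psnd z))"
  shows "computable_pred (\<lambda>x. \<forall>i<b x. P x i)"
proof -
  have "(\<lambda>x. \<forall>i<b x. P x i) = (\<lambda>x. \<not> (\<exists>i<b x. \<not> P x i))" by auto
  then show ?thesis using assms by (simp only:) (intro computable_intros)
qed

text \<open>The searched function is total, so the condition of \<open>mu\<close> on the values
  below the first zero holds, and \<open>mu\<close> returns the least witness.\<close>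

lemma computable_Least [computable_intros]:
  assumes "computable_pred (\<lambda>z. P (pfst z) (psnd z))" "\<And>x. \<exists>n. P x n"
  shows "computable (\<lambda>x. LEAST n. P x n)"
proof -
  have "computable (\<lambda>z. if P (pfst z) (psnd z) then 0 else 1)"
    using assms(1) by (intro computable_intros)
  from partial_recursive.Mu[OF this[unfolded computable_def]]
  have "partial_recursive (\<lambda>x. mu (\<lambda>n. Some (if P x n then 0 else 1)))" by simp
  moreover have "mu (\<lambda>n. Some (if P x n then 0 else 1)) = Some (LEAST n. P x n)" for x
    using assms(2)[of x] by (auto simp: mu_def)
  ultimately show ?thesis by (simp only: computable_def)
qed

section \<open>Arithmetic on codes of lists\<close>

definition ctl :: "nat \<Rightarrow> nat" where "ctl n = (if n = 0 then 0 else psnd (n - 1))"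
definition chd :: "nat \<Rightarrow> nat" where "chd n = pfst (n - 1)"
definition cdrop :: "nat \<Rightarrow> nat \<Rightarrow> nat" where "cdrop n i = rec_nat n (\<lambda>_. ctl) i"
definition cnth :: "nat \<Rightarrow> nat \<Rightarrow> nat" where "cnth n i = chd (cdrop n i)"
text \<open>Only the empty list has code \<open>0\<close>, so the length is the number of tails
  taken until \<open>0\<close> appears. A search finds it.\<close>

definition clen :: "nat \<Rightarrow> nat" where "clen n = (LEAST i. cdrop n i = 0)"

lemma ctl_encode: "ctl (list_encode l) = list_encode (tl l)"
  by (cases l) (auto simp: ctl_def)

lemma list_encode_eq_0_iff: "list_encode l = 0 \<longleftrightarrow> l = []"
  by (cases l) auto

lemma cdrop_encode: "cdrop (list_encode l) i = list_encode (drop i l)"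
  by (induction i) (simp_all add: cdrop_def ctl_encode drop_Suc tl_drop)

lemma chd_encode: "l \<noteq> [] \<Longrightarrow> chd (list_encode l) = hd l"
  by (cases l) (auto simp: chd_def)

lemma cnth_encode: "i < length l \<Longrightarrow> cnth (list_encode l) i = l ! i"
  by (simp add: cnth_def cdrop_encode chd_encode hd_drop_conv_nth)

lemma clen_encode: "clen (list_encode l) = length l"
  unfolding clen_def cdrop_encode list_encode_eq_0_iff by (auto intro!: Least_equality)

lemma computable_ctl [computable_intros]: "computable f \<Longrightarrow> computable (\<lambda>x. ctl (f x))"
  unfolding ctl_def by (intro computable_intros)

lemma computable_chd [computable_intros]: "computable f \<Longrightarrow> computable (\<lambda>x. chd (f x))"
  unfolding chd_def by (intro computable_intros)

lemma computable_cdrop [computable_intros]: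
  "computable f \<Longrightarrow> computable g \<Longrightarrow> computable (\<lambda>x. cdrop (f x) (g x))"
  unfolding cdrop_def by (intro computable_intros)

lemma computable_cnth [computable_intros]:
  "computable f \<Longrightarrow> computable g \<Longrightarrow> computable (\<lambda>x. cnth (f x) (g x))"
  unfolding cnth_def by (intro computable_intros)

lemma computable_clen [computable_intros]:
  assumes "computable f" shows "computable (\<lambda>x. clen (f x))"
proof -
  have "\<exists>i. cdrop n i = 0" for n
    using cdrop_encode[of "list_decode n" "length (list_decode n)"] by auto
  then have "computable clen" unfolding clen_def by (intro computable_intros) simp
  from computable_comp[OF this assms] show ?thesis .
qed

text \<open>List codes grow at the front, so the recursion runs from the last index down: step
  \<open>i\<close> prepends the value at \<open>k x - Suc i\<close>.\<close>

lemma computable_list_encode_map [computable_intros]: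
  assumes "computable k" "computable (\<lambda>z. g (pfst z) (psnd z))"
  shows "computable (\<lambda>x. list_encode (map (g x) [0..<k x]))"
proof -
  have *: "list_encode (map (g x) [k x - m..<k x]) =
      rec_nat 0 (\<lambda>i r. Suc (prod_encode (g x (k x - Suc i), r))) m" if "m \<le> k x" for x m
    using that
  proof (induction m)
    case (Suc m)
    then have "[k x - Suc m..<k x] = (k x - Suc m) # [k x - m..<k x]"
      by (subst upt_conv_Cons) (auto simp: Suc_diff_Suc)
    with Suc show ?case by simp
  qed simp
  have "computable (\<lambda>z. g (pfst z) (k (pfst z) - Suc (pfst (psnd z))))"
    by (intro computable_comp2[OF assms(2)] computable_comp[OF assms(1)] computable_intros)
  then have "computable (\<lambda>x. rec_nat 0 (\<lambda>i r. Suc (prod_encode (g x (k x - Suc i), r))) (k x))"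
    by (intro computable_intros assms)
  then show ?thesis using *[of "k x" x for x] by simp
qed

section \<open>Enumeration of the computable functions\<close>

datatype prog = PZero | PSuc | PLeft | PRight | PPair prog prog | PComp prog prog
  | PRec prog prog | PSearch prog | PMu prog

text \<open>\<open>PSearch f\<close> started at \<open>\<langle>a, n\<rangle>\<close> looks for the first zero of \<open>f\<close> from \<open>n\<close> on; it splits the rule for
  \<open>PMu\<close>, which has unboundedly many premises, into rules with finitely many.\<close>

inductive runs :: "prog \<Rightarrow> nat \<Rightarrow> nat \<Rightarrow> bool" where
  "runs PZero x 0"
| "runs PSuc x (Suc x)"
| "runs PLeft x (pfst x)"
| "runs PRight x (psnd x)"
| "runs f x a \<Longrightarrow> runs g x b \<Longrightarrow> runs (PPair f g) x (prod_encode (a, b))"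
| "runs g x v \<Longrightarrow> runs f v y \<Longrightarrow> runs (PComp f g) x y"
| "runs f a y \<Longrightarrow> runs (PRec f g) (prod_encode (a, 0)) y"
| "runs (PRec f g) (prod_encode (a, k)) v \<Longrightarrow> runs g (prod_encode (a, prod_encode (k, v))) y \<Longrightarrow>
    runs (PRec f g) (prod_encode (a, Suc k)) y"
| "runs f (prod_encode (a, n)) 0 \<Longrightarrow> runs (PSearch f) (prod_encode (a, n)) n"
| "runs f (prod_encode (a, n)) (Suc v) \<Longrightarrow> runs (PSearch f) (prod_encode (a, Suc n)) y \<Longrightarrow>
    runs (PSearch f) (prod_encode (a, n)) y"
| "runs (PSearch f) (prod_encode (a, 0)) y \<Longrightarrow> runs (PMu f) a y"

inductive_cases runs_PZeroE: "runs PZero x y"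
inductive_cases runs_PSucE: "runs PSuc x y"
inductive_cases runs_PLeftE: "runs PLeft x y"
inductive_cases runs_PRightE: "runs PRight x y"
inductive_cases runs_PPairE: "runs (PPair f g) x y"
inductive_cases runs_PCompE: "runs (PComp f g) x y"
inductive_cases runs_PRecE: "runs (PRec f g) x y"
inductive_cases runs_PMuE: "runs (PMu f) x y"

lemma partial_recursive_imp_runs:
  "partial_recursive f \<Longrightarrow> \<exists>p. \<forall>x y. f x = Some y \<longleftrightarrow> runs p x y"
proof (induction rule: partial_recursive.induct)
  case Zero
  show ?case by (rule exI[of _ PZero]) (auto elim: runs_PZeroE intro: runs.intros(1-4))
next
  case Succ
  show ?case by (rule exI[of _ PSuc]) (auto elim: runs_PSucE intro: runs.intros(1-4))
next
  case Left
  show ?case by (rule exI[of _ PLeft]) (auto simp flip: pfst_def elim: runs_PLeftE intro: runs.intros(1-4))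
next
  case Right
  show ?case by (rule exI[of _ PRight]) (auto simp flip: psnd_def elim: runs_PRightE intro: runs.intros(1-4))
next
  case (Pair f g)
  then obtain p q where "\<And>x y. f x = Some y \<longleftrightarrow> runs p x y" "\<And>x y. g x = Some y \<longleftrightarrow> runs q x y" by auto
  moreover have "runs (PPair p q) x y \<longleftrightarrow> (\<exists>a b. runs p x a \<and> runs q x b \<and> prod_encode (a, b) = y)" for x y
    by (rule iffI, erule runs_PPairE) (auto intro: runs.intros(5))
  ultimately show ?case by (intro exI[of _ "PPair p q"]) (simp add: bind_eq_Some_conv)
next
  case (Comp f g)
  then obtain p q where "\<And>x y. f x = Some y \<longleftrightarrow> runs p x y" "\<And>x y. g x = Some y \<longleftrightarrow> runs q x y" by auto
  moreover have "runs (PComp p q) x y \<longleftrightarrow> (\<exists>v. runs q x v \<and> runs p v y)" for x y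
    by (rule iffI, erule runs_PCompE) (auto intro: runs.intros(6))
  ultimately show ?case by (intro exI[of _ "PComp p q"]) (simp add: bind_eq_Some_conv)
next
  case (Prec f g)
  then obtain p q where p: "\<And>x y. f x = Some y \<longleftrightarrow> runs p x y" and q: "\<And>x y. g x = Some y \<longleftrightarrow> runs q x y" by auto
  have "rec_nat (f a) (\<lambda>i r. Option.bind r (\<lambda>v. g (prod_encode (a, prod_encode (i, v))))) k = Some y
      \<longleftrightarrow> runs (PRec p q) (prod_encode (a, k)) y" for a k y
  proof (induction k arbitrary: y)
    case 0
    have "runs (PRec p q) (prod_encode (a, 0)) y \<longleftrightarrow> runs p a y"
      by (rule iffI, erule runs_PRecE) (auto intro: runs.intros(7,8))
    then show ?case by (simp add: p)
  next
    case (Suc k)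
    have "runs (PRec p q) (prod_encode (a, Suc k)) y \<longleftrightarrow> (\<exists>v. runs (PRec p q) (prod_encode (a, k)) v \<and>
        runs q (prod_encode (a, prod_encode (k, v))) y)"
      by (rule iffI, erule runs_PRecE) (auto intro: runs.intros(7,8))
    then show ?case by (simp add: Suc q bind_eq_Some_conv)
  qed
  then have "(case prod_decode n of (a, k) \<Rightarrow> rec_nat (f a) (\<lambda>i r. Option.bind r
      (\<lambda>v. g (prod_encode (a, prod_encode (i, v))))) k) = Some y \<longleftrightarrow> runs (PRec p q) n y" for n y
    by (simp add: split_beta)
  then show ?case by (intro exI[of _ "PRec p q"] allI)
next
  case (Mu f)
  then obtain p where p: "\<And>x y. f x = Some y \<longleftrightarrow> runs p x y" by auto
  \<comment> \<open>The rule induction ranges over all programs; \<open>r = PSearch p\<close>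
    singles out the search. Its starting point \<open>psnd x\<close> stays variable because the
    search calls itself with the next one.\<close>
  have sound: "runs r x y \<Longrightarrow> r = PSearch p \<Longrightarrow> psnd x \<le> y \<and> f (prod_encode (pfst x, y)) = Some 0 \<and>
      (\<forall>m. psnd x \<le> m \<and> m < y \<longrightarrow> (\<exists>v. f (prod_encode (pfst x, m)) = Some (Suc v)))" for r x y
  proof (induction rule: runs.induct)
    case (10 f' a n v y)
    then have "\<exists>v. f (prod_encode (a, m)) = Some (Suc v)" if "n \<le> m" "m < y" for m
      using that by (cases "m = n") (auto simp: p)
    with 10 show ?case by simp
  qed (auto simp: p)
  \<comment> \<open>Induction from \<open>y\<close> downwards: the run from \<open>n\<close> is
    built on the run from \<open>Suc n\<close>.\<close>
  have complete: "runs (PSearch p) (prod_encode (a, n)) y"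
    if "n \<le> y" "f (prod_encode (a, y)) = Some 0"
      "\<forall>m. n \<le> m \<and> m < y \<longrightarrow> (\<exists>v. f (prod_encode (a, m)) = Some (Suc v))" for a n y
    using that
  proof (induction rule: inc_induct)
    case base
    then show ?case by (simp add: p runs.intros(9))
  next
    case (step n)
    then obtain v where "f (prod_encode (a, n)) = Some (Suc v)" by auto
    with step.IH step.prems show ?case by (intro runs.intros(10)[of p a n v y]) (simp_all add: p)
  qed
  \<comment> \<open>\<open>mu\<close> asks that everything below some zero be defined. The least
    zero is not larger, so everything below it is defined and, by minimality, positive.\<close>
  have "mu (\<lambda>n. f (prod_encode (a, n))) = Some y \<longleftrightarrow> f (prod_encode (a, y)) = Some 0 \<and>
      (\<forall>m<y. \<exists>v. f (prod_encode (a, m)) = Some (Suc v))" (is "?l \<longleftrightarrow> ?r") for a y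
  proof
    assume l: ?l
    then obtain n where n: "f (prod_encode (a, n)) = Some 0" "\<forall>m<n. f (prod_encode (a, m)) \<noteq> None"
      and y: "y = (LEAST n. f (prod_encode (a, n)) = Some 0)"
      by (auto simp: mu_def split: if_splits)
    have "y \<le> n" unfolding y by (rule Least_le) (rule n)
    moreover have "f (prod_encode (a, y)) = Some 0" unfolding y by (rule LeastI) (rule n)
    moreover have "\<exists>v. f (prod_encode (a, m)) = Some (Suc v)" if "m < y" for m
    proof -
      from that \<open>y \<le> n\<close> n(2) obtain v where v: "f (prod_encode (a, m)) = Some v" by fastforce
      with \<open>m < y\<close> not_less_Least[of m "\<lambda>n. f (prod_encode (a, n)) = Some 0"] show ?thesis
        unfolding y by (cases v) auto
    qed
    ultimately show ?r by blast
  next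
    assume r: ?r
    have "(LEAST n. f (prod_encode (a, n)) = Some 0) = y"
      using r by (intro Least_equality) (auto simp: not_less[symmetric])
    moreover from r have "\<exists>n. f (prod_encode (a, n)) = Some 0 \<and> (\<forall>m<n. f (prod_encode (a, m)) \<noteq> None)"
      by (intro exI[of _ y]) force
    ultimately show ?l by (simp add: mu_def)
  qed
  moreover have "runs (PMu p) a y \<longleftrightarrow> runs (PSearch p) (prod_encode (a, 0)) y" for a y
    by (blast elim: runs_PMuE intro: runs.intros(11))
  moreover have "runs (PSearch p) (prod_encode (a, 0)) y \<longleftrightarrow> f (prod_encode (a, y)) = Some 0 \<and>
      (\<forall>m<y. \<exists>v. f (prod_encode (a, m)) = Some (Suc v))" for a y
    using sound[of "PSearch p" "prod_encode (a, 0)" y] complete[of 0 y a] by auto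
  ultimately show ?case by (intro exI[of _ "PMu p"] allI) (simp only:)
qed

section \<open>Codes of programs and certificates of computations\<close>

fun prog_code :: "prog \<Rightarrow> nat" where
  "prog_code PZero = prod_encode (0, 0)"
| "prog_code PSuc = prod_encode (1, 0)"
| "prog_code PLeft = prod_encode (2, 0)"
| "prog_code PRight = prod_encode (3, 0)"
| "prog_code (PPair f g) = prod_encode (4, prod_encode (prog_code f, prog_code g))"
| "prog_code (PComp f g) = prod_encode (5, prod_encode (prog_code f, prog_code g))"
| "prog_code (PRec f g) = prod_encode (6, prod_encode (prog_code f, prog_code g))"
| "prog_code (PSearch f) = prod_encode (7, prog_code f)"
| "prog_code (PMu f) = prod_encode (8, prog_code f)"

text \<open>The rules of \<open>runs\<close> read backwards on codes: each disjunct says that the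
  last step was an application of one rule to premises in \<open>R\<close>. The tag
  \<open>pfst e\<close> is the constructor of the program.\<close>

definition justified :: "(nat \<Rightarrow> nat \<Rightarrow> nat \<Rightarrow> bool) \<Rightarrow> nat \<Rightarrow> nat \<Rightarrow> nat \<Rightarrow> bool" where
  "justified R e x y \<longleftrightarrow>
    pfst e = 0 \<and> y = 0 \<or> pfst e = 1 \<and> y = Suc x \<or> pfst e = 2 \<and> y = pfst x \<or> pfst e = 3 \<and> y = psnd x \<or>
    pfst e = 4 \<and> R (pfst (psnd e)) x (pfst y) \<and> R (psnd (psnd e)) x (psnd y) \<or>
    pfst e = 5 \<and> (\<exists>v. R (psnd (psnd e)) x v \<and> R (pfst (psnd e)) v y) \<or>
    pfst e = 6 \<and> psnd x = 0 \<and> R (pfst (psnd e)) (pfst x) y \<or>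
    pfst e = 6 \<and> psnd x \<noteq> 0 \<and> (\<exists>v. R e (prod_encode (pfst x, psnd x - 1)) v \<and>
      R (psnd (psnd e)) (prod_encode (pfst x, prod_encode (psnd x - 1, v))) y) \<or>
    pfst e = 7 \<and> R (psnd e) x 0 \<and> y = psnd x \<or>
    pfst e = 7 \<and> (\<exists>v. R (psnd e) x (Suc v) \<and> R e (prod_encode (pfst x, Suc (psnd x))) y) \<or>
    pfst e = 8 \<and> R (prod_encode (7, psnd e)) (prod_encode (x, 0)) y"

text \<open>\<open>R\<close> occurs only positively.\<close>

lemma justified_mono: "justified R e x y \<Longrightarrow> (\<And>e x y. R e x y \<Longrightarrow> R' e x y) \<Longrightarrow> justified R' e x y"
  unfolding justified_def by (elim disj_forward conj_forward ex_forward) assumption+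

definition claims :: "nat list \<Rightarrow> nat \<Rightarrow> nat \<Rightarrow> nat \<Rightarrow> bool" where
  "claims l e x y \<longleftrightarrow> prod_encode (e, prod_encode (x, y)) \<in> set l"

text \<open>Each claim rests on claims further back in the list, so a valid list read from its end
  is a derivation in \<open>runs\<close>.\<close>

fun valid :: "nat list \<Rightarrow> bool" where
  "valid [] \<longleftrightarrow> True"
| "valid (c # l) \<longleftrightarrow> justified (claims l) (pfst c) (pfst (psnd c)) (psnd (psnd c)) \<and> valid l"

definition certifies :: "nat \<Rightarrow> nat \<Rightarrow> nat \<Rightarrow> nat \<Rightarrow> bool" where
  "certifies c e x y \<longleftrightarrow> valid (list_decode c) \<and> claims (list_decode c) e x y"

text \<open>Appending only enlarges the supply of claims on which the entries of \<open>l\<close>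
  may rest.\<close>

lemma valid_append: "valid l \<Longrightarrow> valid l' \<Longrightarrow> valid (l @ l')"
  by (induction l) (auto elim!: justified_mono simp: claims_def)

lemma justified_sound:
  assumes "justified R (prog_code p) x y" "\<And>p x y. R (prog_code p) x y \<Longrightarrow> runs p x y"
  shows "runs p x y"
proof (cases p)
  case (PPair f g)
  with assms have "runs f x (pfst y)" "runs g x (psnd y)" by (auto simp: justified_def)
  from runs.intros(5)[OF this] PPair show ?thesis by simp
next
  case (PRec f g)
  show ?thesis
  proof (cases "psnd x")
    case 0
    with assms PRec have "runs f (pfst x) y" by (auto simp: justified_def)
    from runs.intros(7)[OF this] 0 PRec show ?thesis by (metis prod_encode_pfst_psnd)
  next
    case (Suc k)
    with assms(1) PRec obtain v where "R (prog_code p) (prod_encode (pfst x, k)) v"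
      "R (prog_code g) (prod_encode (pfst x, prod_encode (k, v))) y" by (auto simp: justified_def)
    with assms(2) PRec have "runs (PRec f g) (prod_encode (pfst x, k)) v"
      "runs g (prod_encode (pfst x, prod_encode (k, v))) y" by auto
    from runs.intros(8)[OF this] Suc PRec show ?thesis by (metis prod_encode_pfst_psnd)
  qed
next
  case (PSearch f)
  with assms(1) consider "R (prog_code f) x 0" "y = psnd x"
    | v where "R (prog_code f) x (Suc v)" "R (prog_code p) (prod_encode (pfst x, Suc (psnd x))) y"
    by (auto simp: justified_def)
  then show ?thesis
  proof cases
    case 1
    then show ?thesis using assms(2) PSearch runs.intros(9)[of f "pfst x" "psnd x"] by auto
  next
    case 2
    then show ?thesis using assms(2) PSearch runs.intros(10)[of f "pfst x" "psnd x" v y] by auto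
  qed
next
  case (PMu f)
  with assms have "R (prog_code (PSearch f)) (prod_encode (x, 0)) y" by (auto simp: justified_def)
  then show ?thesis using assms(2) PMu runs.intros(11) by blast
next
  case (PComp f g)
  with assms show ?thesis by (auto simp: justified_def intro: runs.intros(6))
qed (use assms in \<open>auto simp: justified_def intro: runs.intros(1-4)\<close>)

lemma valid_sound: "valid l \<Longrightarrow> claims l (prog_code p) x y \<Longrightarrow> runs p x y"
proof (induction l arbitrary: p x y)
  case (Cons c l)
  show ?case
  proof (cases "claims l (prog_code p) x y")
    case False
    with Cons.prems have "c = prod_encode (prog_code p, prod_encode (x, y))" by (simp add: claims_def)
    with Cons show ?thesis by (auto intro: justified_sound)
  qed (use Cons in auto)
qed (simp add: claims_def)

lemma valid_extend:
  assumes "justified (claims l) e x y" "valid l"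
  shows "\<exists>l. valid l \<and> claims l e x y"
  using assms by (intro exI[of _ "prod_encode (e, prod_encode (x, y)) # l"]) (simp add: claims_def)

text \<open>Concatenation yields one list containing both claims, as rules with two premises
  require.\<close>

lemma valid_join:
  assumes "\<exists>l. valid l \<and> claims l e x y" "\<exists>l. valid l \<and> claims l e' x' y'"
  shows "\<exists>l. valid l \<and> claims l e x y \<and> claims l e' x' y'"
proof -
  from assms obtain l l' where "valid l" "claims l e x y" "valid l'" "claims l' e' x' y'" by blast
  then show ?thesis by (intro exI[of _ "l @ l'"]) (auto simp: valid_append claims_def)
qed

lemma valid_complete: "runs p x y \<Longrightarrow> \<exists>l. valid l \<and> claims l (prog_code p) x y"
proof (induction rule: runs.induct)
  case (5 f x a g b)
  obtain l where "valid l" "claims l (prog_code f) x a" "claims l (prog_code g) x b"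
    using valid_join[OF "5.IH"] by blast
  then show ?case by (intro valid_extend[of l]) (auto simp: justified_def)
next
  case (6 g x v f y)
  obtain l where "valid l" "claims l (prog_code g) x v" "claims l (prog_code f) v y"
    using valid_join[OF "6.IH"] by blast
  then show ?case by (intro valid_extend[of l]) (auto simp: justified_def)
next
  case (7 f a y g)
  then obtain l where "valid l" "claims l (prog_code f) a y" by blast
  then show ?case by (intro valid_extend[of l]) (auto simp: justified_def)
next
  case (8 f g a k v y)
  obtain l where "valid l" "claims l (prog_code (PRec f g)) (prod_encode (a, k)) v"
    "claims l (prog_code g) (prod_encode (a, prod_encode (k, v))) y" using valid_join[OF "8.IH"] by blast
  then show ?case by (intro valid_extend[of l]) (auto simp: justified_def)
next
  case (9 f a n)
  then obtain l where "valid l" "claims l (prog_code f) (prod_encode (a, n)) 0" by blast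
  then show ?case by (intro valid_extend[of l]) (auto simp: justified_def)
next
  case (10 f a n v y)
  obtain l where "valid l" "claims l (prog_code f) (prod_encode (a, n)) (Suc v)"
    "claims l (prog_code (PSearch f)) (prod_encode (a, Suc n)) y" using valid_join[OF "10.IH"] by blast
  then show ?case by (intro valid_extend[of l]) (auto simp: justified_def)
next
  case (11 f a y)
  then obtain l where "valid l" "claims l (prog_code (PSearch f)) (prod_encode (a, 0)) y" by blast
  then show ?case by (intro valid_extend[of l]) (auto simp: justified_def)
qed (auto intro!: valid_extend[of "[]"] simp: justified_def)

text \<open>A normal form theorem: the index is the code of a program for \<open>f\<close>, and a
  value is correct iff it has a certificate. Bounding the certificate by a stage gives decidable
  approximations to the graph.\<close>

theorem enumeration:
  assumes "computable f"
  obtains e where "\<And>x y. f x = y \<longleftrightarrow> (\<exists>c. certifies c e x y)"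
proof -
  obtain p where p: "\<And>x y. Some (f x) = Some y \<longleftrightarrow> runs p x y"
    using partial_recursive_imp_runs[OF assms[unfolded computable_def]] by blast
  have "f x = y \<longleftrightarrow> (\<exists>c. certifies c (prog_code p) x y)" for x y
    unfolding certifies_def using p[of x y] valid_sound valid_complete[of p x y]
    by (metis list_encode_inverse option.inject)
  then show thesis by (rule that)
qed

text \<open>\<open>claims\<close> on list codes. A list is no longer than its code, hence the bound
  \<open>i < n\<close>; \<open>cdrop n i \<noteq> 0\<close> says that position \<open>i\<close>
  exists.\<close>

definition cclaims :: "nat \<Rightarrow> nat \<Rightarrow> nat \<Rightarrow> nat \<Rightarrow> bool" where
  "cclaims n e x y \<longleftrightarrow> (\<exists>i<n. cdrop n i \<noteq> 0 \<and> cnth n i = prod_encode (e, prod_encode (x, y)))"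

lemma length_le_list_encode: "length l \<le> list_encode l"
proof (induction l)
  case (Cons a l)
  then show ?case using le_prod_encode_2[of "list_encode l" a] by simp
qed simp

lemma member_less_list_encode: "x \<in> set l \<Longrightarrow> x < list_encode l"
proof (induction l)
  case (Cons a l)
  then show ?case using le_prod_encode_2[of "list_encode l" a] le_prod_encode_1[of a "list_encode l"]
    by auto
qed simp

lemma cclaims_encode: "cclaims (list_encode l) = claims l"
proof (intro ext)
  fix e x y
  show "cclaims (list_encode l) e x y = claims l e x y"
    using length_le_list_encode[of l]
    unfolding cclaims_def claims_def cdrop_encode list_encode_eq_0_iff in_set_conv_nth
    by (metis cnth_encode drop_eq_Nil less_le_trans not_less)
qed

lemma claims_less: "claims l e x y \<Longrightarrow> y < list_encode l"
  unfolding claims_def using member_less_list_encode le_prod_encode_2 le_less_trans by meson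

lemma cclaims_less: "cclaims n e x y \<Longrightarrow> y < n"
  using claims_less[of "list_decode n"] cclaims_encode[of "list_decode n"] by simp

lemma computable_pred_cclaims [computable_intros]:
  assumes "computable n" "computable e" "computable x" "computable y"
  shows "computable_pred (\<lambda>z. cclaims (n z) (e z) (x z) (y z))"
  unfolding cclaims_def by (intro computable_intros assms assms[THEN computable_comp_pfst])

lemma computable_pred_justified [computable_intros]:
  assumes "computable n" "computable e" "computable x" "computable y"
  shows "computable_pred (\<lambda>z. justified (cclaims (n z)) (e z) (x z) (y z))"
proof -
  \<comment> \<open>An intermediate value is the output of a listed claim and therefore smaller than
    the code of the list. This bounds the existential quantifiers in
    \<open>justified\<close>.\<close>
  have 1: "(\<exists>v. cclaims n e x v \<and> Q v) \<longleftrightarrow> (\<exists>v<n. cclaims n e x v \<and> Q v)" for n e x Q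
    using cclaims_less by blast
  have 2: "(\<exists>v. cclaims n e x (Suc v) \<and> Q) \<longleftrightarrow> (\<exists>v<n. cclaims n e x (Suc v) \<and> Q)" for n e x Q
    using cclaims_less Suc_lessD by blast
  show ?thesis unfolding justified_def 1 2
    by (intro computable_intros assms assms[THEN computable_comp_pfst])
qed

text \<open>Turns the recursion along the list into a bounded quantifier over positions, which is
  visibly computable.\<close>

lemma valid_iff_nth: "valid l \<longleftrightarrow> (\<forall>i<length l. justified (claims (drop (Suc i) l))
    (pfst (l ! i)) (pfst (psnd (l ! i))) (psnd (psnd (l ! i))))"
  by (induction l) (simp_all add: less_Suc_eq_0_disj all_conj_distrib imp_disjL imp_ex)

lemma valid_list_decode:
  "valid (list_decode n) \<longleftrightarrow> (\<forall>i<n. cdrop n i \<noteq> 0 \<longrightarrow> justified (cclaims (cdrop n (Suc i)))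
    (pfst (cnth n i)) (pfst (psnd (cnth n i))) (psnd (psnd (cnth n i))))"
proof -
  have "valid l \<longleftrightarrow> (\<forall>i<list_encode l. cdrop (list_encode l) i \<noteq> 0 \<longrightarrow>
    justified (cclaims (cdrop (list_encode l) (Suc i))) (pfst (cnth (list_encode l) i))
      (pfst (psnd (cnth (list_encode l) i))) (psnd (psnd (cnth (list_encode l) i))))" for l
    using length_le_list_encode[of l] unfolding valid_iff_nth cdrop_encode cclaims_encode list_encode_eq_0_iff
    by (auto simp: cnth_encode)
  from this[of "list_decode n"] show ?thesis by simp
qed

lemma computable_pred_certifies [computable_intros]:
  assumes "computable n" "computable e" "computable x" "computable y"
  shows "computable_pred (\<lambda>z. certifies (n z) (e z) (x z) (y z))"
proof -
  have "certifies n e x y \<longleftrightarrow> valid (list_decode n) \<and> cclaims n e x y" for n e x y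
    using cclaims_encode[of "list_decode n"] by (simp add: certifies_def)
  show ?thesis unfolding \<open>\<And>n e x y. certifies n e x y \<longleftrightarrow> _ n e x y\<close> valid_list_decode
    by (intro computable_intros assms assms[THEN computable_comp_pfst])
qed

section \<open>Syntax and semantics\<close>

lemma tm_code_inject: "tm_code s = tm_code t \<Longrightarrow> s = t"
proof (induction s arbitrary: t)
  case (Var n)
  then show ?case by (cases t) auto
next
  case (Fn f ss)
  then obtain ts where t: "t = Fn f ts" and eq: "map tm_code ss = map tm_code ts"
    by (cases t) (auto simp: prod_encode_eq list_encode_eq)
  from eq have "ss = ts" using Fn.IH by (rule list.inj_map_strong[rotated]) auto
  with t show ?case by simp
qed

lemma fm_code_inject: "fm_code p = fm_code q \<Longrightarrow> p = q"
proof (induction p arbitrary: q)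
  case (Rel r ts)
  then show ?case
    by (cases q) (auto simp: prod_encode_eq list_encode_eq intro: tm_code_inject injI dest: map_injective)
qed (case_tac q; auto dest: tm_code_inject)+

lemma le_prod_encodeI: "n \<le> a \<or> n \<le> b \<Longrightarrow> n \<le> prod_encode (a, b)"
  using le_prod_encode_1[of a b] le_prod_encode_2[of b a] by linarith

lemma fv_tm_le_code: "n \<in> fv_tm t \<Longrightarrow> n \<le> tm_code t"
proof (induction t)
  case (Fn f ts)
  then obtain t where t: "t \<in> set ts" "n \<le> tm_code t" by auto
  then have "n < list_encode (map tm_code ts)"
    using member_less_list_encode[of "tm_code t" "map tm_code ts"] by auto
  then show ?case by (simp add: le_prod_encodeI)
qed (simp add: le_prod_encodeI)

text \<open>Gives a computable bound for the variables of an arbitrary formula: those below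
  \<open>Suc (fm_code p)\<close> suffice.\<close>

lemma fv_fm_le_code: "n \<in> fv_fm p \<Longrightarrow> n \<le> fm_code p"
proof (induction p arbitrary: n)
  case (Eq s t)
  then show ?case by (auto dest!: fv_tm_le_code simp: le_prod_encodeI)
next
  case (Rel r ts)
  then obtain t where t: "t \<in> set ts" "n \<le> tm_code t" by (auto dest: fv_tm_le_code)
  then have "n < list_encode (map tm_code ts)"
    using member_less_list_encode[of "tm_code t" "map tm_code ts"] by auto
  then show ?case by (simp add: le_prod_encodeI)
next
  case (All p)
  then have "Suc n \<le> fm_code p" by auto
  then show ?case by (simp add: le_prod_encodeI)
qed (auto simp: le_prod_encodeI)

definition assigns :: "'a struct \<Rightarrow> (nat \<Rightarrow> 'a) set" where
  "assigns A = {x. \<forall>i. x i \<in> univ A}"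

lemma eval_cong: "(\<And>n. n \<in> fv_tm t \<Longrightarrow> e n = e' n) \<Longrightarrow> eval A e t = eval A e' t"
  by (induction t) (auto intro!: arg_cong[of _ _ "fun_interp A _"] map_cong)

lemma sat_cong: "(\<And>n. n \<in> fv_fm p \<Longrightarrow> e n = e' n) \<Longrightarrow> sat A e p \<longleftrightarrow> sat A e' p"
proof (induction p arbitrary: e e')
  case (Eq s t)
  then show ?case using eval_cong[of s e e' A] eval_cong[of t e e' A] by auto
next
  case (Rel r ts)
  have "map (eval A e) ts = map (eval A e') ts"
    using Rel by (auto intro!: eval_cong)
  then show ?case by (simp only: sat.simps)
next
  case (Imp p q)
  have "sat A e p \<longleftrightarrow> sat A e' p" by (rule Imp.IH) (use Imp.prems in auto)
  moreover have "sat A e q \<longleftrightarrow> sat A e' q" by (rule Imp.IH) (use Imp.prems in auto)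
  ultimately show ?case by simp
next
  case (Neg p)
  have "sat A e p \<longleftrightarrow> sat A e' p" by (rule Neg.IH) (use Neg.prems in auto)
  then show ?case by simp
next
  case (All p)
  have "sat A (case_nat d e) p \<longleftrightarrow> sat A (case_nat d e') p" for d
    by (rule All.IH) (use All.prems in \<open>auto split: nat.split\<close>)
  then show ?case by simp
qed

lemma eval_subst: "eval A e (subst_tm s t) = eval A (\<lambda>n. eval A e (s n)) t"
  by (induction t) (auto cong: map_cong intro!: arg_cong[of _ _ "fun_interp A _"])

lemma sat_subst: "sat A e (subst_fm s p) \<longleftrightarrow> sat A (\<lambda>n. eval A e (s n)) p"
proof (induction p arbitrary: e s)
  case (All p)
  have "(\<lambda>n. eval A (case_nat d e) (case_nat (Var 0) (\<lambda>n. subst_tm shift (s n)) n)) =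
      case_nat d (\<lambda>n. eval A e (s n))" for d
    by (rule ext) (auto simp: eval_subst shift_def split: nat.split)
  then show ?case by (simp add: All)
qed (auto simp: eval_subst comp_def)

lemma eval_in_univ:
  assumes "is_structure L A" "e \<in> assigns A" "wf_tm L t"
  shows "eval A e t \<in> univ A"
  using assms(3)
proof (induction t)
  case (Fn f ts)
  then show ?case using assms(1) unfolding is_structure_def
    by (auto dest!: spec[of _ f] spec[of _ "map (eval A e) ts"])
qed (use assms in \<open>auto simp: assigns_def\<close>)

lemma case_nat_assigns: "d \<in> univ A \<Longrightarrow> e \<in> assigns A \<Longrightarrow> case_nat d e \<in> assigns A"
  by (auto simp: assigns_def split: nat.split)

lemma wf_subst_tm: "wf_tm L t \<Longrightarrow> (\<And>n. wf_tm L (s n)) \<Longrightarrow> wf_tm L (subst_tm s t)"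
  by (induction t) auto

lemma wf_subst_fm: "wf_fm L p \<Longrightarrow> (\<And>n. wf_tm L (s n)) \<Longrightarrow> wf_fm L (subst_fm s p)"
  by (induction p arbitrary: s) (auto simp: wf_subst_tm shift_def split: nat.split)

lemma sat_inst: "sat A e (inst t p) \<longleftrightarrow> sat A (case_nat (eval A e t) e) p"
proof -
  have "(\<lambda>n. eval A e (case_nat t Var n)) = case_nat (eval A e t) e"
    by (rule ext) (auto split: nat.split)
  then show ?thesis by (simp add: inst_def sat_subst)
qed

text \<open>Validity under all assignments survives unrestricted generalisation. Axioms from
  \<open>T\<close> are sentences, so their truth does not depend on the assignment.\<close>

lemma soundness:
  assumes "is_model L A T" "T \<subseteq> sentences L" "derives L T p" "e \<in> assigns A"
  shows "sat A e p"
  using assms(3,4)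
proof (induction arbitrary: e rule: derives.induct)
  case (Ax p)
  then have "sat A (nth []) p" "fv_fm p = {}" using assms by (auto simp: is_model_def holds_def formulas_def)
  then show ?case using sat_cong[of p "nth []" e A] by simp
next
  case (All_inst p t)
  then show ?case using eval_in_univ[of L A e t] assms(1) by (auto simp: sat_inst is_model_def)
next
  case (All_vacuous p)
  then show ?case by (auto simp: sat_subst shift_def)
qed (auto simp: sat_inst case_nat_assigns)

section \<open>Renamings and universal closure in the calculus\<close>

lemma subst_tm_rename: "subst_tm s (subst_tm (\<lambda>n. Var (r n)) t) = subst_tm (\<lambda>n. s (r n)) t"
  by (induction t) auto

text \<open>Pushing a renaming under a quantifier gives a renaming again, which keeps the induction
  going.\<close>

lemma subst_fm_rename: "subst_fm s (subst_fm (\<lambda>n. Var (r n)) p) = subst_fm (\<lambda>n. s (r n)) p"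
proof (induction p arbitrary: r s)
  case (All p)
  have 1: "case_nat (Var 0) (\<lambda>n. subst_tm shift (Var (r n))) = (\<lambda>n. Var (case_nat 0 (\<lambda>n. Suc (r n)) n))" for r
    by (rule ext) (auto simp: shift_def split: nat.split)
  have 2: "(\<lambda>n. case_nat (Var 0) (\<lambda>n. subst_tm shift (s n)) (case_nat 0 (\<lambda>n. Suc (r n)) n)) =
      case_nat (Var 0) (\<lambda>n. subst_tm shift (s (r n)))"
    by (rule ext) (auto split: nat.split)
  show ?case by (simp add: 1 All 2 del: subst_tm.simps)
qed (auto simp: subst_tm_rename)

lemma subst_tm_id: "(\<And>n. n \<in> fv_tm t \<Longrightarrow> s n = Var n) \<Longrightarrow> subst_tm s t = t"
  by (induction t) (auto intro!: map_idI)

lemma subst_fm_id: "(\<And>n. n \<in> fv_fm p \<Longrightarrow> s n = Var n) \<Longrightarrow> subst_fm s p = p"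
proof (induction p arbitrary: s)
  case (All p)
  have "subst_fm (case_nat (Var 0) (\<lambda>n. subst_tm shift (s n))) p = p"
    by (rule All.IH) (use All.prems in \<open>auto simp: shift_def split: nat.split\<close>)
  then show ?case by simp
next
  case (Rel r ts)
  then show ?case by (auto intro!: map_idI subst_tm_id)
qed (auto simp: subst_tm_id)

definition Alls :: "nat \<Rightarrow> fm \<Rightarrow> fm" where "Alls n p = (All ^^ n) p"

lemma Alls_0 [simp]: "Alls 0 p = p" by (simp add: Alls_def)
lemma Alls_Suc [simp]: "Alls (Suc n) p = All (Alls n p)" by (simp add: Alls_def)

lemma wf_Alls [simp]: "wf_fm L (Alls n p) \<longleftrightarrow> wf_fm L p"
  by (induction n) auto

lemma fv_Alls [simp]: "fv_fm (Alls n p) = {i. i + n \<in> fv_fm p}"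
  by (induction n) auto

lemma subst_Alls:
  "subst_fm (\<lambda>i. Var (r i)) (Alls n p) =
    Alls n (subst_fm (\<lambda>i. Var (if i < n then i else r (i - n) + n)) p)"
proof (induction n arbitrary: r)
  case (Suc n)
  have 1: "case_nat (Var 0) (\<lambda>i. subst_tm shift (Var (r i))) = (\<lambda>i. Var (case_nat 0 (\<lambda>i. Suc (r i)) i))"
    by (rule ext) (auto simp: shift_def split: nat.split)
  have 2: "(if i < n then i else case_nat 0 (\<lambda>i. Suc (r i)) (i - n) + n) =
      (if i < Suc n then i else r (i - Suc n) + Suc n)" for i
    by (cases "i - n") (auto simp: diff_Suc not_less less_Suc_eq)
  show ?case by (simp only: Alls_Suc subst_fm.simps 1 Suc 2)
qed simp

text \<open>The outermost quantifier is instantiated first, by a variable that ends up as \<open>k - 1\<close> once the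
  remaining \<open>k - 1\<close> quantifiers have been removed.\<close>

lemma derives_Alls_rename:
  assumes "derives L T (Alls k (subst_fm (\<lambda>i. Var (r i)) p))" "wf_fm L p"
  shows "derives L T (subst_fm (\<lambda>i. Var (if r i < k then r i else r i - k)) p)"
  using assms
proof (induction k arbitrary: r)
  case (Suc k)
  let ?q = "subst_fm (\<lambda>i. Var (r i)) p"
  have "wf_fm L (Alls k ?q)" using Suc.prems by (simp add: wf_subst_fm)
  then have "derives L T (inst (Var k) (Alls k ?q))"
    using Suc.prems(1) derives.All_inst[of L "Alls k ?q" "Var k" T] derives.MP by auto
  moreover have "inst (Var k) (Alls k ?q) =
      subst_fm (\<lambda>i. Var (case_nat k (\<lambda>j. j) i)) (Alls k ?q)"
    unfolding inst_def by (rule arg_cong[of _ _ "\<lambda>s. subst_fm s _"]) (auto split: nat.split)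
  moreover have "\<dots> = Alls k (subst_fm (\<lambda>i. Var (if r i < k then r i else case_nat k (\<lambda>j. j) (r i - k) + k)) p)"
    by (simp only: subst_Alls subst_fm_rename)
  ultimately have "derives L T (subst_fm (\<lambda>i. Var (let j = if r i < k then r i else case_nat k (\<lambda>j. j) (r i - k) + k in
      if j < k then j else j - k)) p)"
    using Suc.IH[of "\<lambda>i. if r i < k then r i else case_nat k (\<lambda>j. j) (r i - k) + k"] Suc.prems(2)
    by (simp add: Let_def)
  moreover have "(let j = if r i < k then r i else case_nat k (\<lambda>j. j) (r i - k) + k in
      if j < k then j else j - k) = (if r i < Suc k then r i else r i - Suc k)" for i
    by (auto simp: Let_def split: nat.split)
  ultimately show ?case by simp
qed simp

text \<open>Removing the \<open>k\<close> quantifiers leaves a renaming that fixes all indices below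
  \<open>k\<close>, hence every free variable of \<open>p\<close>.\<close>

lemma derives_Alls_iff:
  assumes "p \<in> formulas L k" shows "derives L T (Alls k p) \<longleftrightarrow> derives L T p"
proof
  assume "derives L T (Alls k p)"
  moreover have "subst_fm (\<lambda>i. Var i) p = p" by (rule subst_fm_id) simp
  ultimately have "derives L T (subst_fm (\<lambda>i. Var (if i < k then i else i - k)) p)"
    using derives_Alls_rename[of L T k "\<lambda>i. i" p] assms by (simp add: formulas_def)
  moreover have "subst_fm (\<lambda>i. Var (if i < k then i else i - k)) p = p"
    by (rule subst_fm_id) (use assms in \<open>auto simp: formulas_def\<close>)
  ultimately show "derives L T p" by simp
next
  assume "derives L T p"
  then show "derives L T (Alls k p)" by (induction k) (auto intro: derives.Gen)
qed

definition prepend :: "nat \<Rightarrow> (nat \<Rightarrow> 'a) \<Rightarrow> (nat \<Rightarrow> 'a) \<Rightarrow> nat \<Rightarrow> 'a" where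
  "prepend n x y = (\<lambda>i. if i < n then x i else y (i - n))"

text \<open>The bound variables take their values from the first \<open>n\<close> entries of a whole
  assignment \<open>x\<close>. For \<open>n = 0\<close> the nonempty universe ensures that such an
  \<open>x\<close> exists.\<close>

lemma sat_Alls:
  assumes "univ A \<noteq> {}"
  shows "sat A y (Alls n p) \<longleftrightarrow> (\<forall>x\<in>assigns A. sat A (prepend n x y) p)"
proof (induction n arbitrary: y)
  case 0
  have "assigns A \<noteq> {}" using assms by (auto simp: assigns_def intro!: exI[of _ "\<lambda>_. SOME a. a \<in> univ A"] some_in_eq[THEN iffD2])
  then show ?case by (auto simp: prepend_def)
next
  case (Suc n)
  \<comment> \<open>The outermost of the \<open>Suc n\<close> quantifiers binds the index
    \<open>n\<close> of the formula inside all of them.\<close>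
  have 1: "prepend (Suc n) x y = prepend n x (case_nat (x n) y)" for x
    by (rule ext) (auto simp: prepend_def less_Suc_eq diff_Suc split: nat.split)
  have 2: "prepend n x (case_nat d y) = prepend (Suc n) (x(n := d)) y" for x d
    by (rule ext) (auto simp: prepend_def less_Suc_eq diff_Suc split: nat.split)
  have "sat A y (Alls (Suc n) p) \<longleftrightarrow> (\<forall>d\<in>univ A. \<forall>x\<in>assigns A. sat A (prepend n x (case_nat d y)) p)"
    by (simp add: Suc)
  also have "\<dots> \<longleftrightarrow> (\<forall>x\<in>assigns A. sat A (prepend (Suc n) x y) p)"
  proof
    assume *: "\<forall>d\<in>univ A. \<forall>x\<in>assigns A. sat A (prepend n x (case_nat d y)) p"
    show "\<forall>x\<in>assigns A. sat A (prepend (Suc n) x y) p"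
      unfolding 1 using * by (auto simp: assigns_def)
  next
    assume *: "\<forall>x\<in>assigns A. sat A (prepend (Suc n) x y) p"
    show "\<forall>d\<in>univ A. \<forall>x\<in>assigns A. sat A (prepend n x (case_nat d y)) p"
      unfolding 2 by (intro ballI *[rule_format]) (auto simp: assigns_def)
  qed
  finally show ?case .
qed

section \<open>Existential closure and projection formulas\<close>

definition Exs :: "nat \<Rightarrow> fm \<Rightarrow> fm" where "Exs n p = Neg (Alls n (Neg p))"
definition And :: "fm \<Rightarrow> fm \<Rightarrow> fm" where "And p q = Neg (Imp p (Neg q))"
text \<open>A valid formula with code \<open>0\<close>, which makes it a handy default in recursions
  on codes.\<close>

definition Triv :: fm where "Triv = Eq (Var 0) (Var 0)"

lemma sat_Exs: "univ A \<noteq> {} \<Longrightarrow> sat A y (Exs n p) \<longleftrightarrow> (\<exists>x\<in>assigns A. sat A (prepend n x y) p)"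
  by (auto simp: Exs_def sat_Alls)

lemma wf_Exs [simp]: "wf_fm L (Exs n p) \<longleftrightarrow> wf_fm L p" by (simp add: Exs_def)
lemma fv_Exs [simp]: "fv_fm (Exs n p) = {i. i + n \<in> fv_fm p}" by (simp add: Exs_def)
lemma sat_And [simp]: "sat A e (And p q) \<longleftrightarrow> sat A e p \<and> sat A e q" by (simp add: And_def)
lemma wf_And [simp]: "wf_fm L (And p q) \<longleftrightarrow> wf_fm L p \<and> wf_fm L q" by (simp add: And_def)
lemma fv_And [simp]: "fv_fm (And p q) = fv_fm p \<union> fv_fm q" by (simp add: And_def)
lemma sat_Triv [simp]: "sat A e Triv" by (simp add: Triv_def)
lemma wf_Triv [simp]: "wf_fm L Triv" by (simp add: Triv_def)
lemma fv_Triv [simp]: "fv_fm Triv = {0}" by (simp add: Triv_def)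

primrec eqs :: "(nat \<Rightarrow> nat) \<Rightarrow> (nat \<Rightarrow> nat) \<Rightarrow> nat \<Rightarrow> fm" where
  "eqs u v 0 = Triv"
| "eqs u v (Suc m) = And (eqs u v m) (Eq (Var (u m)) (Var (v m)))"

lemma sat_eqs: "sat A e (eqs u v m) \<longleftrightarrow> (\<forall>i<m. e (u i) = e (v i))"
  by (induction m) (auto simp: less_Suc_eq)

lemma wf_eqs [simp]: "wf_fm L (eqs u v m)"
  by (induction m) auto

lemma fv_eqs: "fv_fm (eqs u v m) = {0} \<union> u ` {..<m} \<union> v ` {..<m}"
  by (induction m) (auto simp: lessThan_Suc)

text \<open>\<open>tie n \<phi> m P u t\<close> says of \<open>z\<close> that some assignment \<open>y\<close> satisfies \<open>\<phi>(y\<^sub>0, \<dots>, y\<^sub>n\<^sub>-\<^sub>1)\<close> and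
  \<open>y (u i) = z (t i)\<close> for all \<open>i < m\<close> with \<open>P i\<close>. It replaces substitution into \<open>\<phi>\<close>, whose effect on codes
  would be harder to compute.\<close>

definition tie :: "nat \<Rightarrow> fm \<Rightarrow> nat \<Rightarrow> (nat \<Rightarrow> bool) \<Rightarrow> (nat \<Rightarrow> nat) \<Rightarrow> (nat \<Rightarrow> nat) \<Rightarrow> fm" where
  "tie n p m P u t =
     Exs n (And p (eqs (\<lambda>i. if P i then u i else 0) (\<lambda>i. if P i then n + t i else 0) m))"

lemma sat_tie:
  assumes "univ A \<noteq> {}" "fv_fm p \<subseteq> {..<n}" "\<And>i. i < m \<Longrightarrow> P i \<Longrightarrow> u i < n"
  shows "sat A z (tie n p m P u t) \<longleftrightarrow>
    (\<exists>y\<in>assigns A. sat A y p \<and> (\<forall>i<m. P i \<longrightarrow> y (u i) = z (t i)))"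
proof -
  have 1: "sat A (prepend n y z) p \<longleftrightarrow> sat A y p" for y
    by (rule sat_cong) (use assms(2) in \<open>auto simp: prepend_def\<close>)
  \<comment> \<open>Where \<open>P i\<close> fails, the conjunct equates variable \<open>0\<close>
    with itself and says nothing.\<close>
  have 2: "sat A (prepend n y z) (eqs (\<lambda>i. if P i then u i else 0) (\<lambda>i. if P i then n + t i else 0) m)
      \<longleftrightarrow> (\<forall>i<m. P i \<longrightarrow> y (u i) = z (t i))" for y
    unfolding sat_eqs using assms(3) by (auto simp: prepend_def)
  show ?thesis by (simp add: tie_def sat_Exs[OF assms(1)] 1 2)
qed

lemma wf_tie [simp]: "wf_fm L (tie n p m P u t) \<longleftrightarrow> wf_fm L p"
  by (simp add: tie_def)

text \<open>The variables of \<open>p\<close>, the \<open>u i\<close> and the index \<open>0\<close>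
  of the dummy equations lie below \<open>n\<close> and are bound; only the \<open>n + t i\<close>
  stay free.\<close>

lemma fv_tie:
  assumes "fv_fm p \<subseteq> {..<n}" "\<And>i. i < m \<Longrightarrow> P i \<Longrightarrow> u i < n" "0 < n"
  shows "fv_fm (tie n p m P u t) \<subseteq> t ` {i. i < m \<and> P i}"
proof
  fix x assume "x \<in> fv_fm (tie n p m P u t)"
  then consider "x + n \<in> fv_fm p" | "x + n = 0" | i where "i < m" "x + n = (if P i then u i else 0)"
    | i where "i < m" "x + n = (if P i then n + t i else 0)"
    by (auto simp: tie_def fv_eqs)
  then show "x \<in> t ` {i. i < m \<and> P i}"
  proof cases
    case 3
    then show ?thesis using assms(2)[of i] assms(3) by (simp split: if_splits)
  qed (use assms in \<open>auto split: if_splits\<close>)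
qed

section \<open>Computability of the formula constructors on codes\<close>

lemma fm_code_Triv [simp]: "fm_code Triv = 0"
  by (simp add: Triv_def prod_encode_def)

lemma computable_code_And [computable_intros]:
  "computable (\<lambda>x. fm_code (p x)) \<Longrightarrow> computable (\<lambda>x. fm_code (q x)) \<Longrightarrow> computable (\<lambda>x. fm_code (And (p x) (q x)))"
  unfolding And_def fm_code.simps by (intro computable_intros)

lemma computable_code_Neg [computable_intros]:
  "computable (\<lambda>x. fm_code (p x)) \<Longrightarrow> computable (\<lambda>x. fm_code (Neg (p x)))"
  unfolding fm_code.simps by (intro computable_intros)

lemma computable_code_Eq_Var [computable_intros]:
  "computable u \<Longrightarrow> computable v \<Longrightarrow> computable (\<lambda>x. fm_code (Eq (Var (u x)) (Var (v x))))"
  unfolding fm_code.simps tm_code.simps by (intro computable_intros)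

lemma fm_code_Alls: "fm_code (Alls n p) = rec_nat (fm_code p) (\<lambda>_ r. prod_encode (4, r)) n"
  by (induction n) auto

lemma computable_code_Alls [computable_intros]:
  "computable n \<Longrightarrow> computable (\<lambda>x. fm_code (p x)) \<Longrightarrow> computable (\<lambda>x. fm_code (Alls (n x) (p x)))"
  unfolding fm_code_Alls by (intro computable_intros)

lemma computable_code_Exs [computable_intros]:
  "computable n \<Longrightarrow> computable (\<lambda>x. fm_code (p x)) \<Longrightarrow> computable (\<lambda>x. fm_code (Exs (n x) (p x)))"
  unfolding Exs_def by (intro computable_intros)

lemma computable_code_eqs [computable_intros]:
  assumes "computable m" "computable (\<lambda>z. u (pfst z) (psnd z))" "computable (\<lambda>z. v (pfst z) (psnd z))"
  shows "computable (\<lambda>x. fm_code (eqs (u x) (v x) (m x)))"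
proof -
  have *: "fm_code (eqs u v m) = rec_nat 0 (\<lambda>i r. prod_encode (2, prod_encode (3, prod_encode (r,
      prod_encode (2, prod_encode (0, prod_encode (prod_encode (0, u i), prod_encode (0, v i)))))))) m" for u v m
    by (induction m) (auto simp: And_def)
  show ?thesis unfolding *
    by (intro computable_intros assms computable_comp2[OF assms(2)] computable_comp2[OF assms(3)])
qed

lemma computable_code_tie [computable_intros]:
  assumes "computable n" "computable (\<lambda>x. fm_code (p x))" "computable m"
    "computable_pred (\<lambda>z. P (pfst z) (psnd z))"
    "computable (\<lambda>z. u (pfst z) (psnd z))" "computable (\<lambda>z. t (pfst z) (psnd z))"
  shows "computable (\<lambda>x. fm_code (tie (n x) (p x) (m x) (P x) (u x) (t x)))"
  unfolding tie_def by (intro computable_intros assms assms(1)[THEN computable_comp_pfst])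

section \<open>The construction\<close>

lemma eventually_bounded_ball:
  fixes n :: nat
  assumes "\<And>i. \<exists>b :: nat. \<forall>s\<ge>b. Q i s"
  shows "\<exists>b. \<forall>s\<ge>b. \<forall>i<n. Q i s"
proof (induction n)
  case (Suc n)
  then obtain b b' where "\<forall>s\<ge>b. \<forall>i<n. Q i s" "\<forall>s\<ge>b'. Q n s" using assms by blast
  then show ?case by (intro exI[of _ "max b b'"]) (auto simp: less_Suc_eq)
qed simp

locale decidable_model =
  fixes L :: lang and T :: "fm set" and A :: "nat struct"
  assumes complete_theory: "complete_theory L T"
    and is_model: "is_model L A T"
    and decidable_structure: "decidable_structure L A"
begin

lemma is_structure: "is_structure L A" and univ_nonempty: "univ A \<noteq> {}"
  using is_model by (auto simp: is_model_def is_structure_def)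

definition a0 :: nat where "a0 = (SOME a. a \<in> univ A)"

lemma a0_in: "a0 \<in> univ A"
  unfolding a0_def using univ_nonempty by (simp add: some_in_eq)

definition realized :: "fm \<Rightarrow> bool" where
  "realized p \<longleftrightarrow> (\<exists>y\<in>assigns A. sat A y p)"

text \<open>At stage \<open>s\<close> the number \<open>\<langle>a, b\<rangle> < s\<close> belongs to the known part of the graph of the \<open>e\<close>-th
  partial recursive function, restricted to \<open>univ A\<close>.\<close>

definition conv :: "nat \<Rightarrow> nat \<Rightarrow> nat \<Rightarrow> bool" where
  "conv e s p \<longleftrightarrow> pfst p \<in> univ A \<and> (\<exists>c<s. certifies c e (pfst p) (psnd p))"

text \<open>The assignment sends each known value back to its argument, as the inverse of an
  embedding would.\<close>

definition matches :: "nat \<Rightarrow> nat \<Rightarrow> (nat \<Rightarrow> nat) \<Rightarrow> bool" where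
  "matches e s y \<longleftrightarrow> (\<forall>p<s. conv e s p \<longrightarrow> y (psnd p) = pfst p)"

text \<open>The formula \<open>\<chi>(b)\<close>: what \<open>p\<close> says about the constants
  known to be values. They keep their own indices, so both index functions are
  \<open>psnd\<close>.\<close>

definition chi :: "nat \<Rightarrow> nat \<Rightarrow> fm \<Rightarrow> fm" where
  "chi e s p = tie (Suc s) p s (conv e s) psnd psnd"

text \<open>Lets the variable \<open>a\<close> name the element \<open>a\<close>; the default
  \<open>a0\<close> makes this an assignment into \<open>A\<close>.\<close>

definition param :: "nat \<Rightarrow> nat" where "param a = (if a \<in> univ A then a else a0)"

text \<open>The first conjunct is \<open>\<chi>(a)\<close> in \<open>A\<close>: the same projection,
  with the free variables placed at the arguments \<open>pfst\<close> and evaluated by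
  \<open>param\<close>. The second is consistency of \<open>\<not> \<chi>(b)\<close> with
  \<open>p\<close>.\<close>

definition acts :: "nat \<Rightarrow> nat \<Rightarrow> fm \<Rightarrow> fm \<Rightarrow> bool" where
  "acts e s p t \<longleftrightarrow> sat A param (tie (Suc s) (And p t) s (conv e s) psnd pfst) \<and>
     realized (And p (Neg (chi e s (And p t))))"

text \<open>A total decoding of numbers. The restriction to \<open>formulas L (Suc j)\<close>
  excludes no well-formed formula, because variables are bounded by codes.\<close>

definition sigma :: "nat \<Rightarrow> fm" where
  "sigma j = (if j \<in> fm_code ` formulas L (Suc j) then THE p. fm_code p = j else Triv)"

definition choice :: "fm \<Rightarrow> nat \<Rightarrow> fm" where
  "choice p j = (if realized (And p (sigma j)) then sigma j else Neg (sigma j))"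

text \<open>Stage \<open>s\<close> is devoted to the formula with code \<open>pfst s\<close>, so every formula is treated infinitely often.
  The requirements \<open>e < pfst s\<close> are consulted from the weakest to the strongest, and the strongest acting
  one has the last word. The bound on \<open>e\<close> ensures that in the end each formula is decided.\<close>

primrec proposal :: "nat \<Rightarrow> fm \<Rightarrow> nat \<Rightarrow> fm" where
  "proposal s p 0 = choice p (pfst s)"
| "proposal s p (Suc i) = (if acts (pfst s - Suc i) s p (proposal s p i)
     then Neg (chi (pfst s - Suc i) s (And p (proposal s p i))) else proposal s p i)"

text \<open>The witness is the variable \<open>Suc s\<close>, which has index \<open>Suc (Suc s)\<close> under the quantifier and does not
  occur in \<open>stage s\<close>.\<close>

definition henkin :: "nat \<Rightarrow> fm" where
  "henkin s = (case sigma (pfst s) of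
     All q \<Rightarrow> Imp (All (Imp (Eq (Var 0) (Var (Suc (Suc s)))) q)) (All q) | _ \<Rightarrow> Triv)"

primrec stage :: "nat \<Rightarrow> fm" where
  "stage 0 = Triv"
| "stage (Suc s) = And (And (stage s) (proposal s (stage s) (pfst s))) (henkin s)"

section \<open>Variables and consistency of the stages\<close>

lemma pfst_le: "pfst n \<le> n" and psnd_le: "psnd n \<le> n"
  using le_prod_encode_1[of "pfst n" "psnd n"] le_prod_encode_2[of "psnd n" "pfst n"] by simp_all

lemma psnd_less_Suc: "p < s \<Longrightarrow> psnd p < Suc s"
  using psnd_le[of p] by simp

lemma sat_chi:
  assumes "fv_fm p \<subseteq> {..<Suc s}"
  shows "sat A x (chi e s p) \<longleftrightarrow>
    (\<exists>y\<in>assigns A. sat A y p \<and> (\<forall>q<s. conv e s q \<longrightarrow> y (psnd q) = x (psnd q)))"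
  unfolding chi_def
  by (rule sat_tie) (use assms univ_nonempty psnd_less_Suc in auto)

lemma wf_chi [simp]: "wf_fm L (chi e s p) \<longleftrightarrow> wf_fm L p"
  by (simp add: chi_def)

lemma fv_chi: "fv_fm p \<subseteq> {..<Suc s} \<Longrightarrow> fv_fm (chi e s p) \<subseteq> {..<Suc s}"
proof -
  assume "fv_fm p \<subseteq> {..<Suc s}"
  then have "fv_fm (chi e s p) \<subseteq> psnd ` {i. i < s \<and> conv e s i}"
    unfolding chi_def
    by (rule fv_tie) (use psnd_less_Suc in auto)
  also have "\<dots> \<subseteq> {..<Suc s}" using psnd_less_Suc by auto
  finally show ?thesis .
qed

lemma sigma_fm_code: "p \<in> formulas L n \<Longrightarrow> sigma (fm_code p) = p"
proof -
  assume "p \<in> formulas L n"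
  then have "p \<in> formulas L (Suc (fm_code p))"
    using fv_fm_le_code[of _ p] by (auto simp: formulas_def less_Suc_eq_le)
  then show ?thesis by (auto simp: sigma_def intro!: the_equality dest: fm_code_inject)
qed

lemma sigma_formula: "sigma j \<in> formulas L (Suc j)"
proof (cases "j \<in> fm_code ` formulas L (Suc j)")
  case True
  then obtain p where "p \<in> formulas L (Suc j)" "j = fm_code p" by auto
  then show ?thesis using sigma_fm_code[of p "Suc j"] by simp
qed (simp add: sigma_def formulas_def)

lemma wf_sigma [simp]: "wf_fm L (sigma j)" and fv_sigma: "fv_fm (sigma j) \<subseteq> {..<Suc j}"
  using sigma_formula[of j] by (auto simp: formulas_def)

lemma wf_proposal: "wf_fm L p \<Longrightarrow> wf_fm L (proposal s p i)"
  by (induction i) (auto simp: choice_def)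

lemma fv_proposal: "fv_fm p \<subseteq> {..<Suc s} \<Longrightarrow> fv_fm (proposal s p i) \<subseteq> {..<Suc s}"
proof (induction i)
  case 0
  then show ?case using fv_sigma[of "pfst s"] pfst_le[of s] by (auto simp: choice_def)
next
  case (Suc i)
  then show ?case using fv_chi[of "And p (proposal s p i)" s "pfst s - Suc i"] by auto
qed

text \<open>When a requirement replaces the proposal, the second conjunct of \<open>acts\<close>
  says exactly that the replacement is realized together with \<open>p\<close>.\<close>

lemma realized_proposal: "realized p \<Longrightarrow> realized (And p (proposal s p i))"
  by (induction i) (auto simp: choice_def acts_def realized_def)

lemma wf_henkin [simp]: "wf_fm L (henkin s)"
  using wf_sigma[of "pfst s"] by (auto simp: henkin_def split: fm.split simp del: wf_sigma)

lemma fv_henkin: "fv_fm (henkin s) \<subseteq> {..<Suc (Suc s)}"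
proof -
  have "fv_fm (sigma (pfst s)) \<subseteq> {..<Suc s}" using fv_sigma[of "pfst s"] pfst_le[of s] by auto
  then show ?thesis by (auto simp: henkin_def split: fm.split)
qed

text \<open>The variable \<open>Suc s\<close> is still free to choose: it takes a counterexample to
  \<open>q\<close> if there is one, and otherwise the axiom holds because \<open>All q\<close>
  does.\<close>

lemma henkin_extension:
  assumes "y \<in> assigns A" "sat A y p" "fv_fm p \<subseteq> {..<Suc s}"
  shows "\<exists>v. y(Suc s := v) \<in> assigns A \<and> sat A (y(Suc s := v)) (And p (henkin s))"
proof -
  have fresh: "sat A (y(Suc s := v)) q \<longleftrightarrow> sat A y q" if "fv_fm q \<subseteq> {..<Suc s}" for q v
    by (rule sat_cong) (use that in auto)
  have triv: ?thesis if "\<And>v. v \<in> univ A \<Longrightarrow> sat A (y(Suc s := v)) (henkin s)"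
    using that assms a0_in by (intro exI[of _ a0]) (auto simp: fresh assigns_def)
  show ?thesis
  proof (cases "\<exists>q. sigma (pfst s) = All q")
    case True
    then obtain q where q: "sigma (pfst s) = All q" by auto
    have fv: "fv_fm (All q) \<subseteq> {..<Suc s}" unfolding q[symmetric]
      using fv_sigma[of "pfst s"] pfst_le[of s] by auto
    obtain v where v: "v \<in> univ A" "\<not> sat A (case_nat v y) q \<or> sat A y (All q)"
      using a0_in by auto
    have "sat A (case_nat v (y(Suc s := v))) q \<longleftrightarrow> sat A (case_nat v y) q"
      by (rule sat_cong) (use fv in \<open>auto split: nat.split\<close>)
    moreover have "sat A (y(Suc s := v)) (All q) \<longleftrightarrow> sat A y (All q)" by (rule fresh) (rule fv)
    ultimately have "sat A (y(Suc s := v)) (henkin s)"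
      using v unfolding henkin_def q by auto
    with v assms show ?thesis by (intro exI[of _ v]) (auto simp: fresh assigns_def)
  next
    case False
    then have "henkin s = Triv" by (auto simp: henkin_def split: fm.split)
    then show ?thesis by (intro triv) simp
  qed
qed

lemma wf_stage [simp]: "wf_fm L (stage s)"
  by (induction s) (auto simp: wf_proposal)

lemma fv_stage: "fv_fm (stage s) \<subseteq> {..<Suc s}"
proof (induction s)
  case (Suc s)
  from fv_proposal[OF Suc, of "pfst s"] fv_henkin[of s] Suc show ?case by (auto simp: subset_eq)
qed auto

lemma fv_stage_proposal: "fv_fm (And (stage s) (proposal s (stage s) i)) \<subseteq> {..<Suc s}"
  using fv_stage[of s] fv_proposal[OF fv_stage, of s i] by auto

text \<open>Known arguments lie in \<open>univ A\<close>, where \<open>param\<close> is the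
  identity; so the first conjunct of \<open>acts\<close> becomes a statement about
  \<open>matches\<close>.\<close>

lemma acts_stage_iff:
  "acts e s (stage s) (proposal s (stage s) i) \<longleftrightarrow>
    (\<exists>y\<in>assigns A. sat A y (And (stage s) (proposal s (stage s) i)) \<and> matches e s y) \<and>
    realized (And (stage s) (Neg (chi e s (And (stage s) (proposal s (stage s) i)))))"
proof -
  let ?p = "And (stage s) (proposal s (stage s) i)"
  have "sat A param (tie (Suc s) ?p s (conv e s) psnd pfst) \<longleftrightarrow>
      (\<exists>y\<in>assigns A. sat A y ?p \<and> (\<forall>q<s. conv e s q \<longrightarrow> y (psnd q) = param (pfst q)))"
    by (rule sat_tie[OF univ_nonempty fv_stage_proposal psnd_less_Suc])
  also have "\<dots> \<longleftrightarrow> (\<exists>y\<in>assigns A. sat A y ?p \<and> matches e s y)"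
    by (simp add: matches_def conv_def param_def cong: conj_cong imp_cong)
  finally show ?thesis by (simp only: acts_def)
qed

lemma realized_stage: "realized (stage s)"
proof (induction s)
  case 0
  show ?case using a0_in by (auto simp: realized_def assigns_def intro!: exI[of _ "\<lambda>_. a0"])
next
  case (Suc s)
  from realized_proposal[OF this, of s "pfst s"]
  obtain y where "y \<in> assigns A" "sat A y (And (stage s) (proposal s (stage s) (pfst s)))"
    by (auto simp: realized_def)
  from henkin_extension[OF this fv_stage_proposal] show ?case by (auto simp: realized_def)
qed

section \<open>Each requirement prevails at most once\<close>

lemma stage_mono: "s \<le> t \<Longrightarrow> sat A y (stage t) \<Longrightarrow> sat A y (stage s)"
  by (induction rule: dec_induct) auto

lemma conv_mono: "s \<le> t \<Longrightarrow> conv e s p \<Longrightarrow> conv e t p"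
  by (auto simp: conv_def intro: less_le_trans)

lemma matches_antimono: "s \<le> t \<Longrightarrow> matches e t y \<Longrightarrow> matches e s y"
  unfolding matches_def using conv_mono less_le_trans by blast

text \<open>The steps of \<open>proposal\<close> run through the requirements from
  \<open>pfst s - 1\<close> down to \<open>0\<close>, so requirement \<open>e\<close> meets the
  proposal left after \<open>pfst s - Suc e\<close> steps.\<close>

abbreviation acting :: "nat \<Rightarrow> nat \<Rightarrow> bool" where
  "acting e s \<equiv> e < pfst s \<and> acts e s (stage s) (proposal s (stage s) (pfst s - Suc e))"

definition wins :: "nat \<Rightarrow> nat \<Rightarrow> bool" where
  "wins e s \<longleftrightarrow> acting e s \<and> (\<forall>e'<e. \<not> acting e' s)"

text \<open>The last \<open>e\<close> steps belong to the requirements below \<open>e\<close>; if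
  none of them acts, the proposal stays as it is.\<close>

lemma proposal_final:
  assumes "\<And>e'. e' < e \<Longrightarrow> \<not> acting e' s" "e \<le> pfst s"
  shows "proposal s (stage s) (pfst s) = proposal s (stage s) (pfst s - e)"
  using assms
proof (induction e)
  case (Suc e)
  then have "proposal s (stage s) (pfst s) = proposal s (stage s) (pfst s - e)" by simp
  also have "pfst s - e = Suc (pfst s - Suc e)" using Suc.prems by simp
  also have "pfst s - Suc (pfst s - Suc e) = e" using Suc.prems(2) by simp
  then have "proposal s (stage s) (Suc (pfst s - Suc e)) = proposal s (stage s) (pfst s - Suc e)"
    using Suc.prems(1)[of e] Suc.prems(2) by simp
  finally show ?case .
qed simp

text \<open>The win put \<open>\<not> \<chi>(b)\<close> into the stage, while some matching
  \<open>y'\<close> satisfies the formula that \<open>\<chi>\<close> projects. A matching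
  \<open>y\<close> agrees with \<open>y'\<close> on the known constants and would satisfy
  \<open>\<chi>(b)\<close>.\<close>

lemma wins_blocks:
  assumes "wins e s" "s < t" "y \<in> assigns A" "sat A y (stage t)"
  shows "\<not> matches e t y"
proof
  assume m: "matches e t y"
  let ?q = "proposal s (stage s) (pfst s - Suc e)"
  have e: "e < pfst s" and act: "acts e s (stage s) ?q" using assms(1) by (auto simp: wins_def)
  have "proposal s (stage s) (pfst s) = proposal s (stage s) (pfst s - e)"
    by (rule proposal_final) (use assms(1) in \<open>auto simp: wins_def\<close>)
  also have "pfst s - e = Suc (pfst s - Suc e)" using e by simp
  also have "pfst s - Suc (pfst s - Suc e) = e" using e by simp
  then have "proposal s (stage s) (Suc (pfst s - Suc e)) = Neg (chi e s (And (stage s) ?q))"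
    using act by simp
  finally have "sat A y (Neg (chi e s (And (stage s) ?q)))"
    using stage_mono[of "Suc s" t y] assms by simp
  moreover obtain y' where "y' \<in> assigns A" "sat A y' (And (stage s) ?q)" "matches e s y'"
    using act by (auto simp: acts_stage_iff)
  moreover have "matches e s y" using matches_antimono[OF _ m] assms(2) by simp
  ultimately show False
    using sat_chi[OF fv_stage_proposal, of y e s "pfst s - Suc e"] by (auto simp: matches_def)
qed

text \<open>Acting presupposes a matching assignment that satisfies the current stage, and an
  earlier win rules this out.\<close>

lemma wins_once: "wins e s \<Longrightarrow> wins e t \<Longrightarrow> s = t"
proof (induction s t rule: linorder_wlog)
  case (le s t)
  show ?case
  proof (rule ccontr)
    assume "s \<noteq> t"
    with le have "s < t" by simp
    from le(3) obtain y where "y \<in> assigns A" "sat A y (stage t)" "matches e t y"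
      by (auto simp: wins_def acts_stage_iff)
    with wins_blocks[OF le(2) \<open>s < t\<close>] show False by blast
  qed
qed auto

text \<open>Whenever some requirement up to \<open>e\<close> acts, the least acting one wins, and
  there are only finitely many such wins.\<close>

lemma eventually_not_acting: "\<exists>s0. \<forall>s\<ge>s0. \<forall>e'\<le>e. \<not> acting e' s"
proof -
  have "finite {s. wins e' s}" for e'
  proof (cases "\<exists>s. wins e' s")
    case True
    then obtain s where "wins e' s" ..
    then have "{s. wins e' s} \<subseteq> {s}" using wins_once by blast
    then show ?thesis using finite_subset by blast
  qed auto
  then have "finite (\<Union>e'\<in>{..e}. {s. wins e' s})" by blast
  then obtain s0 where s0: "\<And>s e'. e' \<le> e \<Longrightarrow> wins e' s \<Longrightarrow> s < s0"
    unfolding finite_nat_set_iff_bounded by auto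
  have "\<not> acting e' s" if "s0 \<le> s" "e' \<le> e" for s e'
  proof
    assume act: "acting e' s"
    define m where "m = (LEAST m. acting m s)"
    have "acting m s" unfolding m_def by (rule LeastI[of "\<lambda>m. acting m s", OF act])
    moreover have "\<forall>k<m. \<not> acting k s" unfolding m_def using not_less_Least by blast
    ultimately have "wins m s" by (simp add: wins_def)
    moreover have "m \<le> e'" unfolding m_def by (rule Least_le[of "\<lambda>m. acting m s", OF act])
    ultimately show False using s0[of m s] that by simp
  qed
  then show ?thesis by blast
qed

section \<open>Decisions made by the stages\<close>

definition forced :: "((nat \<Rightarrow> nat) \<Rightarrow> bool) \<Rightarrow> bool" where
  "forced P \<longleftrightarrow> (\<exists>s. \<forall>y\<in>assigns A. sat A y (stage s) \<longrightarrow> P y)"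

lemma forced_sigma: "forced (\<lambda>y. sat A y (sigma j)) \<or> forced (\<lambda>y. \<not> sat A y (sigma j))"
proof -
  obtain s0 where s0: "\<And>s e. s0 \<le> s \<Longrightarrow> e \<le> j \<Longrightarrow> \<not> acting e s"
    using eventually_not_acting[of j] by blast
  \<comment> \<open>A stage devoted to \<open>j\<close>, with second component \<open>s0\<close> to
    make it so late that no requirement below \<open>j\<close> acts.\<close>
  define s where "s = prod_encode (j, s0)"
  have s: "pfst s = j" "s0 \<le> s" by (simp_all add: s_def le_prod_encode_2)
  have "\<not> acting e s" if "e < j" for e using s0[OF s(2), of e] that by simp
  from proposal_final[of j s, OF this] have "proposal s (stage s) j = choice (stage s) j"
    using s(1) by simp
  then have "\<forall>y\<in>assigns A. sat A y (stage (Suc s)) \<longrightarrow> sat A y (choice (stage s) j)"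
    using s(1) by simp
  then show ?thesis unfolding forced_def choice_def
    by (cases "realized (And (stage s) (sigma j))") (auto simp del: stage.simps)
qed

text \<open>Wait until the requirements up to \<open>e\<close> are silent and the formulas with
  codes up to \<open>e\<close> are decided. A later stage with \<open>pfst t \<le> e\<close> only
  repeats a decision. At any other, requirement \<open>e\<close> is consulted and declines; as the
  assumption gives the first conjunct of \<open>acts\<close>, the second fails, so
  \<open>stage t\<close> implies \<open>\<chi>(b)\<close>.\<close>

lemma eventually_no_strengthening:
  assumes "\<And>t. \<exists>y\<in>assigns A. sat A y (stage t) \<and> matches e t y"
  shows "\<exists>s0. \<forall>t\<ge>s0. \<forall>y\<in>assigns A. sat A y (stage t) \<longrightarrow>
    (\<exists>y'\<in>assigns A. sat A y' (stage (Suc t)) \<and> (\<forall>p<t. conv e t p \<longrightarrow> y' (psnd p) = y (psnd p)))"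
proof -
  obtain s1 where s1: "\<And>s e'. s1 \<le> s \<Longrightarrow> e' \<le> e \<Longrightarrow> \<not> acting e' s"
    using eventually_not_acting[of e] by blast
  have "\<exists>s. \<forall>t\<ge>s. (\<forall>y\<in>assigns A. sat A y (stage t) \<longrightarrow> sat A y (sigma j)) \<or>
      (\<forall>y\<in>assigns A. sat A y (stage t) \<longrightarrow> \<not> sat A y (sigma j))" for j
    using forced_sigma[of j] unfolding forced_def by (meson stage_mono)
  then obtain d where d: "\<And>j t. d j \<le> t \<Longrightarrow> (\<forall>y\<in>assigns A. sat A y (stage t) \<longrightarrow> sat A y (sigma j)) \<or>
      (\<forall>y\<in>assigns A. sat A y (stage t) \<longrightarrow> \<not> sat A y (sigma j))"
    by metis
  define s0 where "s0 = Max (insert s1 (d ` {..e}))"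
  have s0: "s1 \<le> s0" "\<And>j. j \<le> e \<Longrightarrow> d j \<le> s0" unfolding s0_def by (rule Max_ge; simp)+
  have "\<exists>y'\<in>assigns A. sat A y' (stage (Suc t)) \<and> (\<forall>p<t. conv e t p \<longrightarrow> y' (psnd p) = y (psnd p))"
    if t: "s0 \<le> t" and y: "y \<in> assigns A" "sat A y (stage t)" for t y
  proof -
    let ?q = "proposal t (stage t) (pfst t)"
    have "\<exists>y'\<in>assigns A. sat A y' (And (stage t) ?q) \<and> (\<forall>p<t. conv e t p \<longrightarrow> y' (psnd p) = y (psnd p))"
    proof (cases "pfst t \<le> e")
      case True
      have "?q = choice (stage t) (pfst t)"
        using proposal_final[of "pfst t" t] s1[of t] True t s0(1) by auto
      moreover have "sat A y (choice (stage t) (pfst t))"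
        using d[of "pfst t" t] s0(2)[OF True] t y realized_stage[of t]
        unfolding choice_def by (auto simp: realized_def)
      ultimately show ?thesis using y by (intro bexI[of _ y]) auto
    next
      case False
      then have e: "Suc e \<le> pfst t" by simp
      have q: "?q = proposal t (stage t) (pfst t - Suc e)"
        using proposal_final[of "Suc e" t] s1[of t] e t s0(1) by (auto simp: less_Suc_eq_le)
      obtain y0 where "y0 \<in> assigns A" "sat A y0 (stage (Suc t))" "matches e (Suc t) y0"
        using assms by blast
      then have "\<exists>y\<in>assigns A. sat A y (And (stage t) ?q) \<and> matches e t y"
        using matches_antimono[of t "Suc t" e y0] by (intro bexI[of _ y0]) auto
      moreover have "\<not> acts e t (stage t) ?q"
        using s1[of t e] e t s0(1) unfolding q by auto
      ultimately have "\<not> realized (And (stage t) (Neg (chi e t (And (stage t) ?q))))"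
        by (auto simp: acts_stage_iff)
      with y have "sat A y (chi e t (And (stage t) ?q))" by (auto simp: realized_def)
      then show ?thesis using sat_chi[OF fv_stage_proposal, of y e t "pfst t"] by blast
    qed
    then obtain y' where y': "y' \<in> assigns A" "sat A y' (And (stage t) ?q)"
      "\<forall>p<t. conv e t p \<longrightarrow> y' (psnd p) = y (psnd p)" by blast
    \<comment> \<open>The Henkin axiom costs only a change at \<open>Suc t\<close>, an index beyond
      all known values.\<close>
    from henkin_extension[OF y'(1,2) fv_stage_proposal] obtain v where
      v: "y'(Suc t := v) \<in> assigns A" "sat A (y'(Suc t := v)) (stage (Suc t))" by auto
    have "psnd p \<noteq> Suc t" if "p < t" for p using psnd_le[of p] that by simp
    then show ?thesis using v y'(3) by (intro bexI[of _ "y'(Suc t := v)"]) auto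
  qed
  then show ?thesis by blast
qed

subsection \<open>The constructed model\<close>

lemma forced_mono: "forced P \<Longrightarrow> (\<And>y. y \<in> assigns A \<Longrightarrow> P y \<Longrightarrow> Q y) \<Longrightarrow> forced Q"
  unfolding forced_def by blast

lemma forced_conj: "forced P \<Longrightarrow> forced Q \<Longrightarrow> forced (\<lambda>y. P y \<and> Q y)"
  unfolding forced_def
proof (elim exE)
  fix s t
  assume "\<forall>y\<in>assigns A. sat A y (stage s) \<longrightarrow> P y" "\<forall>y\<in>assigns A. sat A y (stage t) \<longrightarrow> Q y"
  then show "\<exists>s. \<forall>y\<in>assigns A. sat A y (stage s) \<longrightarrow> P y \<and> Q y"
    using stage_mono[of s "max s t"] stage_mono[of t "max s t"] by (intro exI[of _ "max s t"]) auto
qed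

lemma forced_mono2:
  "forced P \<Longrightarrow> forced Q \<Longrightarrow> (\<And>y. y \<in> assigns A \<Longrightarrow> P y \<Longrightarrow> Q y \<Longrightarrow> R y) \<Longrightarrow> forced R"
  by (rule forced_mono[OF forced_conj[of P Q]]) auto

lemma forced_ball: "finite X \<Longrightarrow> (\<And>x. x \<in> X \<Longrightarrow> forced (P x)) \<Longrightarrow> forced (\<lambda>y. \<forall>x\<in>X. P x y)"
proof (induction rule: finite_induct)
  case empty
  show ?case by (auto simp: forced_def)
next
  case (insert x F)
  then have "forced (P x)" "forced (\<lambda>y. \<forall>x\<in>F. P x y)" by auto
  then show ?case by (rule forced_mono2) auto
qed

lemma forced_all: "(\<And>y. y \<in> assigns A \<Longrightarrow> P y) \<Longrightarrow> forced P"
  by (auto simp: forced_def)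

lemma not_forced_False: "\<not> forced (\<lambda>_. False)"
  using realized_stage by (auto simp: forced_def realized_def)

lemma sigma_self: "wf_fm L p \<Longrightarrow> sigma (fm_code p) = p"
  using fv_fm_le_code[of _ p] by (intro sigma_fm_code[of p "Suc (fm_code p)"]) (auto simp: formulas_def less_Suc_eq_le)

lemma sat_rename: "sat A y (subst_fm (\<lambda>i. Var (r i)) p) \<longleftrightarrow> sat A (\<lambda>i. y (r i)) p"
  by (simp add: sat_subst)

text \<open>The renamed formula is itself some \<open>sigma j\<close>, hence decided. The renaming
  \<open>r\<close> allows evaluation at an arbitrary sequence of constants.\<close>

lemma forced_not_iff:
  assumes "wf_fm L p"
  shows "forced (\<lambda>y. \<not> sat A (\<lambda>i. y (r i)) p) \<longleftrightarrow> \<not> forced (\<lambda>y. sat A (\<lambda>i. y (r i)) p)"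
proof -
  let ?p = "subst_fm (\<lambda>i. Var (r i)) p"
  have "sigma (fm_code ?p) = ?p" using assms by (intro sigma_self wf_subst_fm) auto
  then have "forced (\<lambda>y. sat A (\<lambda>i. y (r i)) p) \<or> forced (\<lambda>y. \<not> sat A (\<lambda>i. y (r i)) p)"
    using forced_sigma[of "fm_code ?p"] by (simp add: sat_rename)
  moreover have "\<not> (forced (\<lambda>y. sat A (\<lambda>i. y (r i)) p) \<and> forced (\<lambda>y. \<not> sat A (\<lambda>i. y (r i)) p))"
    using forced_mono2[of _ _ "\<lambda>_. False"] not_forced_False by blast
  ultimately show ?thesis by blast
qed

text \<open>The negation of \<open>All q\<close> is then forced, and the Henkin axiom of a stage
  devoted to the renamed formula makes \<open>q\<close> fail at the constant
  \<open>Suc s\<close>.\<close>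

lemma not_forced_All_witness:
  assumes "wf_fm L q" "\<not> forced (\<lambda>y. sat A (\<lambda>i. y (r i)) (All q))"
  shows "\<exists>m. \<not> forced (\<lambda>y. sat A (case_nat (y m) (\<lambda>i. y (r i))) q)"
proof -
  let ?q = "subst_fm (case_nat (Var 0) (\<lambda>n. shift (r n))) q"
  define s where "s = prod_encode (fm_code (All ?q), 0)"
  have "wf_fm L (All ?q)" using assms(1) by (auto intro!: wf_subst_fm simp: shift_def split: nat.split)
  then have "sigma (pfst s) = All ?q" by (simp only: s_def sigma_self pfst_encode)
  then have h: "henkin s = Imp (All (Imp (Eq (Var 0) (Var (Suc (Suc s)))) ?q)) (All ?q)"
    by (simp add: henkin_def)
  have q: "sat A (case_nat d y) ?q \<longleftrightarrow> sat A (case_nat d (\<lambda>i. y (r i))) q" for d y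
  proof -
    have "(\<lambda>n. eval A (case_nat d y) (case_nat (Var 0) (\<lambda>n. shift (r n)) n)) =
        case_nat d (\<lambda>i. y (r i))"
      by (rule ext) (auto simp: shift_def split: nat.split)
    then show ?thesis by (simp only: sat_subst)
  qed
  have "forced (\<lambda>y. sat A y (henkin s))" unfolding forced_def by (intro exI[of _ "Suc s"]) auto
  moreover have "forced (\<lambda>y. \<not> sat A (\<lambda>i. y (r i)) (All q))"
    using assms by (subst forced_not_iff) auto
  ultimately have "forced (\<lambda>y. \<not> sat A (case_nat (y (Suc s)) (\<lambda>i. y (r i))) q)"
    by (rule forced_mono2) (auto simp: h q)
  then have "\<not> forced (\<lambda>y. sat A (case_nat (y (Suc s)) (\<lambda>i. y (r i))) q)"
    using forced_mono2[of _ _ "\<lambda>_. False"] not_forced_False by blast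
  then show ?thesis ..
qed

text \<open>No stage forces \<open>t\<close> to differ from every element, since \<open>t\<close>
  has a value in \<open>A\<close>; the witness for this failure is the constant sought.\<close>

lemma forced_term_value:
  assumes "wf_tm L t"
  shows "\<exists>m. forced (\<lambda>y. eval A (\<lambda>i. y (r i)) t = y m)"
proof -
  let ?q = "Neg (Eq (subst_tm shift t) (Var 0))"
  have wf: "wf_fm L ?q" using assms by (auto intro: wf_subst_tm simp: shift_def)
  have q: "sat A (case_nat d e) ?q \<longleftrightarrow> eval A e t \<noteq> d" for d and e :: "nat \<Rightarrow> nat"
    by (simp add: eval_subst shift_def)
  have "\<not> forced (\<lambda>y. sat A (\<lambda>i. y (r i)) (All ?q))"
  proof
    assume "forced (\<lambda>y. sat A (\<lambda>i. y (r i)) (All ?q))"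
    then have "forced (\<lambda>_. False)"
    proof (rule forced_mono)
      fix y assume y: "y \<in> assigns A" "sat A (\<lambda>i. y (r i)) (All ?q)"
      then have "eval A (\<lambda>i. y (r i)) t \<in> univ A"
        using eval_in_univ[OF is_structure _ assms, of "\<lambda>i. y (r i)"] by (auto simp: assigns_def)
      with y(2) q show False by (simp only: sat.simps) blast
    qed
    then show False using not_forced_False by simp
  qed
  from not_forced_All_witness[OF wf this] obtain m where
    m: "\<not> forced (\<lambda>y. sat A (case_nat (y m) (\<lambda>i. y (r i))) ?q)" ..
  have eq: "case_nat (y m) (\<lambda>i. y (r i)) = (\<lambda>i. y (case_nat m r i))" for y :: "nat \<Rightarrow> nat"
    by (rule ext) (auto split: nat.split)
  have "forced (\<lambda>y. \<not> sat A (case_nat (y m) (\<lambda>i. y (r i))) ?q)"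
    using m forced_not_iff[OF wf, of "case_nat m r"] unfolding eq by blast
  then show ?thesis unfolding q by auto
qed

definition rep :: "nat \<Rightarrow> nat" where "rep n = (LEAST m. forced (\<lambda>y. y m = y n))"

text \<open>The universe consists of the least constant of each class of forced equality. Thus
  equality becomes identity and the elements are natural numbers.\<close>

definition model :: "nat struct" where
  "model = \<lparr>univ = {n. \<forall>m<n. \<not> forced (\<lambda>y. y m = y n)},
     fun_interp = (\<lambda>f bs. LEAST m. forced (\<lambda>y. fun_interp A f (map y bs) = y m)),
     rel_interp = (\<lambda>r bs. forced (\<lambda>y. rel_interp A r (map y bs)))\<rparr>"

lemma in_univ_model: "n \<in> univ model \<longleftrightarrow> (\<forall>m<n. \<not> forced (\<lambda>y. y m = y n))"
  by (simp add: model_def)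

lemma Least_in_univ_model:
  assumes "\<exists>m. forced (\<lambda>y. P y = y m)"
  shows "(LEAST m. forced (\<lambda>y. P y = y m)) \<in> univ model \<and>
    forced (\<lambda>y. P y = y (LEAST m. forced (\<lambda>y. P y = y m)))"
proof -
  let ?n = "LEAST m. forced (\<lambda>y. P y = y m)"
  have n: "forced (\<lambda>y. P y = y ?n)" using assms by (rule LeastI_ex)
  have "\<not> forced (\<lambda>y. y m = y ?n)" if "m < ?n" for m
  proof
    assume "forced (\<lambda>y. y m = y ?n)"
    with n have "forced (\<lambda>y. P y = y m)" by (rule forced_mono2) simp
    with that show False using not_less_Least[of m "\<lambda>m. forced (\<lambda>y. P y = y m)"] by simp
  qed
  with n show ?thesis by (simp add: in_univ_model)
qed

lemma rep_in_univ: "rep n \<in> univ model" and forced_rep: "forced (\<lambda>y. y (rep n) = y n)"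
proof -
  have eq: "rep n = (LEAST m. forced (\<lambda>y. y n = y m))"
    unfolding rep_def by (rule arg_cong[of _ _ Least]) (auto simp: eq_commute intro: forced_mono)
  have "\<exists>m. forced (\<lambda>y. y n = y m)" by (rule exI[of _ n]) (auto intro: forced_all)
  from Least_in_univ_model[OF this] show "rep n \<in> univ model" "forced (\<lambda>y. y (rep n) = y n)"
    by (auto simp: eq eq_commute)
qed

lemma rep_eq: "n \<in> univ model \<Longrightarrow> rep n = n"
  unfolding rep_def
  by (rule Least_equality) (auto simp: in_univ_model not_less[symmetric] intro: forced_all)

lemma fun_interp_model:
  assumes "fun_arity L f = Some (length bs)"
  shows "fun_interp model f bs \<in> univ model \<and>
    forced (\<lambda>y. fun_interp A f (map y bs) = y (fun_interp model f bs))"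
proof -
  have "wf_tm L (Fn f (map Var bs))" using assms by auto
  from forced_term_value[OF this, of "\<lambda>i. i"]
  have "\<exists>m. forced (\<lambda>y. fun_interp A f (map y bs) = y m)" by (simp add: comp_def)
  from Least_in_univ_model[OF this] show ?thesis by (simp add: model_def)
qed

lemma eval_model:
  assumes "wf_tm L t"
  shows "eval model (\<lambda>i. rep (r i)) t \<in> univ model \<and>
    forced (\<lambda>y. eval A (\<lambda>i. y (r i)) t = y (eval model (\<lambda>i. rep (r i)) t))"
  using assms
proof (induction t)
  case (Var n)
  then show ?case using rep_in_univ[of "r n"] forced_rep[of "r n"] by (simp add: eq_commute)
next
  case (Fn f ts)
  let ?bs = "map (eval model (\<lambda>i. rep (r i))) ts"
  from Fn have "forced (\<lambda>y. \<forall>t\<in>set ts. eval A (\<lambda>i. y (r i)) t = y (eval model (\<lambda>i. rep (r i)) t))"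
    by (intro forced_ball) auto
  moreover have f: "fun_interp model f ?bs \<in> univ model \<and>
      forced (\<lambda>y. fun_interp A f (map y ?bs) = y (fun_interp model f ?bs))"
    by (rule fun_interp_model) (use Fn.prems in simp)
  then have "forced (\<lambda>y. fun_interp A f (map y ?bs) = y (fun_interp model f ?bs))" ..
  ultimately have "forced (\<lambda>y. fun_interp A f (map (eval A (\<lambda>i. y (r i))) ts) = y (fun_interp model f ?bs))"
  proof (rule forced_mono2)
    fix y assume "\<forall>t\<in>set ts. eval A (\<lambda>i. y (r i)) t = y (eval model (\<lambda>i. rep (r i)) t)"
    then have "map (eval A (\<lambda>i. y (r i))) ts = map y ?bs" by auto
    moreover assume "fun_interp A f (map y ?bs) = y (fun_interp model f ?bs)"
    ultimately show "fun_interp A f (map (eval A (\<lambda>i. y (r i))) ts) = y (fun_interp model f ?bs)"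
      by (simp only:)
  qed
  with f show ?case by simp
qed

text \<open>The truth lemma. Equality uses least representatives, \<open>Neg\<close> and
  \<open>Imp\<close> use that everything is decided, \<open>All\<close> uses Henkin witnesses. The
  arbitrary \<open>r\<close> carries the induction under quantifiers.\<close>

theorem sat_model:
  assumes "wf_fm L p"
  shows "sat model (\<lambda>i. rep (r i)) p \<longleftrightarrow> forced (\<lambda>y. sat A (\<lambda>i. y (r i)) p)"
  using assms
proof (induction p arbitrary: r)
  case (Eq s t)
  let ?m = "eval model (\<lambda>i. rep (r i)) s" and ?n = "eval model (\<lambda>i. rep (r i)) t"
  have s: "?m \<in> univ model" "forced (\<lambda>y. eval A (\<lambda>i. y (r i)) s = y ?m)"
    and t: "?n \<in> univ model" "forced (\<lambda>y. eval A (\<lambda>i. y (r i)) t = y ?n)"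
    using eval_model[of s r] eval_model[of t r] Eq by auto
  show ?case
  proof
    assume "sat model (\<lambda>i. rep (r i)) (Eq s t)"
    then have "?m = ?n" by simp
    with s(2) have "forced (\<lambda>y. eval A (\<lambda>i. y (r i)) s = y ?n)" by simp
    with t(2) show "forced (\<lambda>y. sat A (\<lambda>i. y (r i)) (Eq s t))" by (rule forced_mono2) simp
  next
    assume "forced (\<lambda>y. sat A (\<lambda>i. y (r i)) (Eq s t))"
    with s(2) have "forced (\<lambda>y. eval A (\<lambda>i. y (r i)) t = y ?m)" by (rule forced_mono2) simp
    with t(2) have eq: "forced (\<lambda>y. y ?m = y ?n)" by (rule forced_mono2) simp
    then have eq': "forced (\<lambda>y. y ?n = y ?m)" by (rule forced_mono) simp
    have "?m = ?n"
      using s(1) t(1) eq eq' unfolding in_univ_model by (metis linorder_neqE_nat)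
    then show "sat model (\<lambda>i. rep (r i)) (Eq s t)" by simp
  qed
next
  case (Rel k ts)
  let ?bs = "map (eval model (\<lambda>i. rep (r i))) ts"
  have *: "forced (\<lambda>y. \<forall>t\<in>set ts. eval A (\<lambda>i. y (r i)) t = y (eval model (\<lambda>i. rep (r i)) t))"
    using Rel eval_model by (intro forced_ball) auto
  have eq: "map (eval A (\<lambda>i. y (r i))) ts = map y ?bs"
    if "\<forall>t\<in>set ts. eval A (\<lambda>i. y (r i)) t = y (eval model (\<lambda>i. rep (r i)) t)" for y
    using that by auto
  have "forced (\<lambda>y. rel_interp A k (map y ?bs)) \<longleftrightarrow> forced (\<lambda>y. rel_interp A k (map (eval A (\<lambda>i. y (r i))) ts))"
  proof
    assume "forced (\<lambda>y. rel_interp A k (map y ?bs))"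
    with * show "forced (\<lambda>y. rel_interp A k (map (eval A (\<lambda>i. y (r i))) ts))"
      by (rule forced_mono2) (simp only: eq)
  next
    assume "forced (\<lambda>y. rel_interp A k (map (eval A (\<lambda>i. y (r i))) ts))"
    with * show "forced (\<lambda>y. rel_interp A k (map y ?bs))"
      by (rule forced_mono2) (simp only: eq)
  qed
  then show ?case by (simp add: model_def)
next
  case (Neg p)
  then show ?case using forced_not_iff[of p r] by simp
next
  case (Imp p q)
  let ?P = "\<lambda>y. sat A (\<lambda>i. y (r i)) p" and ?Q = "\<lambda>y. sat A (\<lambda>i. y (r i)) q"
  have "forced (\<lambda>y. ?P y \<longrightarrow> ?Q y) \<longleftrightarrow> (forced ?P \<longrightarrow> forced ?Q)"
  proof
    assume "forced (\<lambda>y. ?P y \<longrightarrow> ?Q y)"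
    then show "forced ?P \<longrightarrow> forced ?Q" using forced_mono2[of "\<lambda>y. ?P y \<longrightarrow> ?Q y" ?P ?Q] by blast
  next
    assume "forced ?P \<longrightarrow> forced ?Q"
    then consider "forced (\<lambda>y. \<not> ?P y)" | "forced ?Q" using forced_not_iff[of p r] Imp.prems by auto
    then show "forced (\<lambda>y. ?P y \<longrightarrow> ?Q y)" by cases (auto elim: forced_mono)
  qed
  then show ?case using Imp by simp
next
  case (All q)
  have r: "(\<lambda>i. rep (case_nat d r i)) = case_nat (rep d) (\<lambda>i. rep (r i))"
    "(\<lambda>i. y (case_nat d r i)) = case_nat (y d) (\<lambda>i. y (r i))" for d and y :: "nat \<Rightarrow> nat"
    by (auto split: nat.split)
  have IH: "sat model (case_nat (rep d) (\<lambda>i. rep (r i))) q \<longleftrightarrow>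
      forced (\<lambda>y. sat A (case_nat (y d) (\<lambda>i. y (r i))) q)" for d
    using All.IH[of "case_nat d r"] All.prems by (simp add: r)
  have "sat model (\<lambda>i. rep (r i)) (All q) \<longleftrightarrow> (\<forall>d. sat model (case_nat (rep d) (\<lambda>i. rep (r i))) q)"
    using rep_in_univ rep_eq by (auto simp: Ball_def) (metis rep_eq)
  also have "\<dots> \<longleftrightarrow> (\<forall>d. forced (\<lambda>y. sat A (case_nat (y d) (\<lambda>i. y (r i))) q))" by (simp only: IH)
  also have "\<dots> \<longleftrightarrow> forced (\<lambda>y. sat A (\<lambda>i. y (r i)) (All q))"
  proof
    assume "\<forall>d. forced (\<lambda>y. sat A (case_nat (y d) (\<lambda>i. y (r i))) q)"
    then show "forced (\<lambda>y. sat A (\<lambda>i. y (r i)) (All q))"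
      using not_forced_All_witness[of q r] All.prems by auto
  next
    assume "forced (\<lambda>y. sat A (\<lambda>i. y (r i)) (All q))"
    then show "\<forall>d. forced (\<lambda>y. sat A (case_nat (y d) (\<lambda>i. y (r i))) q)"
      by (intro allI, elim forced_mono) (auto simp: assigns_def)
  qed
  finally show ?case .
qed

lemma holds_model:
  assumes "p \<in> formulas L (length bs)" "set bs \<subseteq> univ model"
  shows "holds model p bs \<longleftrightarrow> forced (\<lambda>y. sat A (\<lambda>i. y (bs ! i)) p)"
proof -
  have "holds model p bs \<longleftrightarrow> sat model (\<lambda>i. rep (bs ! i)) p"
    unfolding holds_def using assms by (intro sat_cong) (auto simp: formulas_def rep_eq subset_eq)
  then show ?thesis using sat_model[of p "nth bs"] assms by (simp add: formulas_def)
qed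

lemma is_model_model: "is_model L model T"
proof -
  have "0 \<in> univ model" by (simp add: in_univ_model)
  then have "is_structure L model" using fun_interp_model by (auto simp: is_structure_def)
  moreover have "holds model p []" if "p \<in> T" for p
  proof -
    have p: "p \<in> formulas L 0" using that complete_theory by (auto simp: complete_theory_def)
    have "sat A (nth []) p" using that is_model by (auto simp: is_model_def holds_def)
    then have "sat A e p" for e using sat_cong[of p "nth []" e A] p by (auto simp: formulas_def)
    then show ?thesis using holds_model[of p "[]"] p by (auto intro: forced_all)
  qed
  ultimately show ?thesis by (simp add: is_model_def)
qed

subsection \<open>Decidability of the constructed model\<close>

definition diagram :: "nat set" where
  "diagram = (\<lambda>(p, as). prod_encode (fm_code p, list_encode as)) ` elementary_diagram L A"

lemma computable_pred_diagram: "computable f \<Longrightarrow> computable_pred (\<lambda>x. f x \<in> diagram)"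
  using decidable_structure computable_pred_comp[of "\<lambda>n. n \<in> diagram" f]
  by (simp add: decidable_structure_def computable_set_def computable_pred_def diagram_def)

lemma in_diagram_iff:
  "prod_encode (fm_code p, list_encode as) \<in> diagram \<longleftrightarrow>
    set as \<subseteq> univ A \<and> p \<in> formulas L (length as) \<and> holds A p as"
  unfolding diagram_def elementary_diagram_def
  by (auto simp: prod_encode_eq list_encode_eq dest: fm_code_inject)

lemma computable_pred_univ [computable_intros]:
  assumes "computable f" shows "computable_pred (\<lambda>x. f x \<in> univ A)"
proof -
  \<comment> \<open>\<open>0\<close> is the code of \<open>Triv\<close>, and the second component
    codes the list \<open>[a]\<close>.\<close>
  have "a \<in> univ A \<longleftrightarrow> prod_encode (0, Suc (prod_encode (a, 0))) \<in> diagram" for a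
    using in_diagram_iff[of Triv "[a]"] by (auto simp: formulas_def holds_def)
  then show ?thesis by (simp only:) (intro computable_pred_diagram computable_intros assms)
qed

text \<open>A formula or its negation holds at the tuple with all entries \<open>a0\<close>, so two
  queries to the diagram recognize codes of formulas without any parsing.\<close>

lemma code_of_formula_iff:
  "j \<in> fm_code ` formulas L k \<longleftrightarrow>
    prod_encode (j, list_encode (map (\<lambda>_. a0) [0..<k])) \<in> diagram \<or>
    prod_encode (prod_encode (2, j), list_encode (map (\<lambda>_. a0) [0..<k])) \<in> diagram" (is "?l \<longleftrightarrow> ?r")
proof
  assume ?l
  then obtain p where p: "j = fm_code p" "p \<in> formulas L k" by auto
  then show ?r using in_diagram_iff[of p "map (\<lambda>_. a0) [0..<k]"] in_diagram_iff[of "Neg p" "map (\<lambda>_. a0) [0..<k]"] a0_in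
    by (auto simp: formulas_def holds_def)
next
  assume ?r
  then obtain p as where p: "(p, as) \<in> elementary_diagram L A" "list_encode as = list_encode (map (\<lambda>_. a0) [0..<k])"
    "fm_code p = j \<or> fm_code p = prod_encode (2, j)"
    unfolding diagram_def by (auto simp: prod_encode_eq)
  then have "length as = k" by (auto simp: list_encode_eq)
  with p(1) have pk: "p \<in> formulas L k" by (auto simp: elementary_diagram_def)
  from p(3) show ?l
  proof
    assume "fm_code p = prod_encode (2, j)"
    then obtain q where "p = Neg q" "fm_code q = j" by (cases p) (auto simp: prod_encode_eq)
    with pk show ?l by (auto simp: formulas_def)
  qed (use pk in auto)
qed

lemma computable_pred_code_of_formula [computable_intros]:
  assumes "computable f" "computable k"
  shows "computable_pred (\<lambda>x. f x \<in> fm_code ` formulas L (k x))"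
  unfolding code_of_formula_iff by (intro computable_pred_diagram computable_intros assms)

lemma fm_code_sigma: "fm_code (sigma j) = (if j \<in> fm_code ` formulas L (Suc j) then j else 0)"
proof (cases "j \<in> fm_code ` formulas L (Suc j)")
  case True
  then obtain p where "p \<in> formulas L (Suc j)" "j = fm_code p" by auto
  then show ?thesis using sigma_fm_code[of p "Suc j"] True by simp
qed (simp add: sigma_def)

lemma computable_code_sigma [computable_intros]:
  "computable f \<Longrightarrow> computable (\<lambda>x. fm_code (sigma (f x)))"
  unfolding fm_code_sigma by (intro computable_intros)

lemma wf_in_formulas: "wf_fm L p \<Longrightarrow> p \<in> formulas L (Suc (fm_code p))"
  using fv_fm_le_code[of _ p] by (auto simp: formulas_def less_Suc_eq_le)

text \<open>The first \<open>Suc (fm_code p)\<close> values of the assignment settle the matter,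
  which leaves one query to the diagram.\<close>

lemma computable_pred_sat:
  assumes "computable (\<lambda>x. fm_code (p x))" "\<And>x. wf_fm L (p x)"
    "computable (\<lambda>z. g (pfst z) (psnd z))" "\<And>x i. g x i \<in> univ A"
  shows "computable_pred (\<lambda>x. sat A (g x) (p x))"
proof -
  have "sat A (g x) (p x) \<longleftrightarrow>
      prod_encode (fm_code (p x), list_encode (map (g x) [0..<Suc (fm_code (p x))])) \<in> diagram" for x
  proof -
    have "sat A (g x) (p x) \<longleftrightarrow> sat A (nth (map (g x) [0..<Suc (fm_code (p x))])) (p x)"
      by (rule sat_cong) (use fv_fm_le_code[of _ "p x"] in \<open>auto simp: nth_append less_Suc_eq_le le_less simp del: upt_Suc\<close>)
    then show ?thesis unfolding in_diagram_iff using wf_in_formulas[OF assms(2), of x] assms(4)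
      by (auto simp: holds_def simp del: upt_Suc)
  qed
  then show ?thesis
    by (simp only:) (intro computable_pred_diagram computable_intros assms)
qed

text \<open>Quantifying over enough variables turns the search for an assignment into the truth of a
  single formula.\<close>

lemma realized_iff: "wf_fm L p \<Longrightarrow> realized p \<longleftrightarrow> sat A (\<lambda>_. a0) (Exs (Suc (fm_code p)) p)"
proof -
  assume "wf_fm L p"
  then have "fv_fm p \<subseteq> {..<Suc (fm_code p)}" using wf_in_formulas by (auto simp: formulas_def)
  then have "sat A (prepend (Suc (fm_code p)) x y) p \<longleftrightarrow> sat A x p" for x y
    by (intro sat_cong) (auto simp: prepend_def)
  then show ?thesis by (simp add: realized_def sat_Exs[OF univ_nonempty])
qed

lemma computable_pred_realized:
  assumes "computable (\<lambda>x. fm_code (p x))" "\<And>x. wf_fm L (p x)"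
  shows "computable_pred (\<lambda>x. realized (p x))"
  unfolding realized_iff[OF assms(2)]
  by (intro computable_pred_sat computable_intros assms) (simp_all add: assms a0_in)

lemma computable_param [computable_intros]: "computable f \<Longrightarrow> computable (\<lambda>x. param (f x))"
  unfolding param_def by (intro computable_intros)

lemma param_in: "param a \<in> univ A"
  by (simp add: param_def a0_in)

lemma computable_pred_conv [computable_intros]:
  assumes "computable e" "computable s" "computable p"
  shows "computable_pred (\<lambda>x. conv (e x) (s x) (p x))"
  unfolding conv_def by (intro computable_intros assms assms[THEN computable_comp_pfst])

lemma computable_code_chi [computable_intros]:
  assumes "computable e" "computable s" "computable (\<lambda>x. fm_code (p x))"
  shows "computable (\<lambda>x. fm_code (chi (e x) (s x) (p x)))"
  unfolding chi_def by (intro computable_intros assms assms[THEN computable_comp_pfst])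

lemma computable_pred_acts:
  assumes "computable e" "computable s" "computable (\<lambda>x. fm_code (p x))" "computable (\<lambda>x. fm_code (q x))"
    "\<And>x. wf_fm L (p x)" "\<And>x. wf_fm L (q x)"
  shows "computable_pred (\<lambda>x. acts (e x) (s x) (p x) (q x))"
  unfolding acts_def
  by (intro computable_intros computable_pred_sat computable_pred_realized assms(1-4) assms(1-4)[THEN computable_comp_pfst])
    (simp_all add: assms param_in)

lemma computable_code_choice [computable_intros]:
  assumes "computable (\<lambda>x. fm_code (p x))" "computable j" "\<And>x. wf_fm L (p x)"
  shows "computable (\<lambda>x. fm_code (choice (p x) (j x)))"
proof -
  have "computable_pred (\<lambda>x. realized (And (p x) (sigma (j x))))"
    by (intro computable_pred_realized computable_intros assms) (simp add: assms)
  then show ?thesis unfolding choice_def if_distrib[of fm_code] by (intro computable_intros assms)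
qed

lemma computable_code_proposal:
  assumes "computable s" "computable (\<lambda>x. fm_code (p x))" "computable i" "\<And>x. wf_fm L (p x)"
  shows "computable (\<lambda>x. fm_code (proposal (s x) (p x) (i x)))"
proof -
  define step where "step s p i q = (if acts (pfst s - Suc i) s p q
     then Neg (chi (pfst s - Suc i) s (And p q)) else q)" for s p i q
  \<comment> \<open>The recursion is carried out on codes, and \<open>sigma\<close> recovers the
    formula at each step.\<close>
  have *: "fm_code (proposal s p i) =
      rec_nat (fm_code (choice p (pfst s))) (\<lambda>i r. fm_code (step s p i (sigma r))) i"
    if "wf_fm L p" for s p i
  proof (induction i)
    case (Suc i)
    have "sigma (fm_code (proposal s p i)) = proposal s p i" using that by (intro sigma_self wf_proposal)
    then show ?case unfolding nat.rec(2) Suc.IH[symmetric] by (simp add: step_def)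
  qed simp
  note comp = assms(1,2)[THEN computable_comp_pfst]
  have "computable (\<lambda>x. rec_nat (fm_code (choice (p x) (pfst (s x)))) (\<lambda>i r. fm_code (step (s x) (p x) i (sigma r))) (i x))"
    unfolding step_def if_distrib[of fm_code]
    by (intro computable_intros computable_pred_acts assms comp) (simp_all add: assms)
  then show ?thesis by (simp only: *[OF assms(4)])
qed

text \<open>Tag \<open>4\<close> marks a quantified formula: then \<open>j\<close> is the code of
  \<open>All q\<close> and \<open>psnd j\<close> that of \<open>q\<close>.\<close>

lemma fm_code_henkin:
  "fm_code (henkin s) = (let j = fm_code (sigma (pfst s)) in if pfst j = 4 then
     prod_encode (3, prod_encode (prod_encode (4, prod_encode (3, prod_encode
       (fm_code (Eq (Var 0) (Var (Suc (Suc s)))), psnd j))), j)) else 0)"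
  by (cases "sigma (pfst s)") (simp_all add: henkin_def Let_def del: fm_code.simps(1), simp_all)

lemma computable_code_henkin [computable_intros]:
  assumes "computable s" shows "computable (\<lambda>x. fm_code (henkin (s x)))"
  unfolding fm_code_henkin Let_def by (intro computable_intros assms)

lemma computable_code_stage [computable_intros]:
  assumes "computable f" shows "computable (\<lambda>x. fm_code (stage (f x)))"
proof -
  define step where "step s p = And (And p (proposal s p (pfst s))) (henkin s)" for s p
  have *: "fm_code (stage s) = rec_nat 0 (\<lambda>s r. fm_code (step s (sigma r))) s" for s
  proof (induction s)
    case (Suc s)
    show ?case unfolding nat.rec(2) Suc.IH[symmetric] by (simp add: step_def sigma_self)
  qed simp
  have "computable (\<lambda>s. rec_nat 0 (\<lambda>s r. fm_code (step s (sigma r))) s)"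
    unfolding step_def by (intro computable_intros computable_code_proposal) simp
  from computable_comp[OF this assms] show ?thesis by (simp only: *)
qed

text \<open>Consistency of \<open>p\<close>, read at the constants listed in \<open>l\<close>, with
  \<open>stage t\<close>, written as one formula. The number \<open>Suc (t + l)\<close> exceeds both
  the variables of the stage and the entries of \<open>l\<close>.\<close>

definition compatible :: "nat \<Rightarrow> fm \<Rightarrow> nat \<Rightarrow> bool" where
  "compatible t p l \<longleftrightarrow> sat A (\<lambda>_. a0) (Exs (clen l) (And p
     (tie (Suc (t + l)) (stage t) (clen l) (\<lambda>_. True) (cnth l) (\<lambda>i. i))))"

lemma compatible_encode:
  assumes "p \<in> formulas L (length bs)"
  shows "compatible t p (list_encode bs) \<longleftrightarrow>
    (\<exists>y\<in>assigns A. sat A y (stage t) \<and> sat A (\<lambda>i. y (bs ! i)) p)"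
proof -
  let ?k = "length bs" and ?l = "list_encode bs"
  have 1: "sat A z (tie (Suc (t + ?l)) (stage t) ?k (\<lambda>_. True) (cnth ?l) (\<lambda>i. i)) \<longleftrightarrow>
      (\<exists>y\<in>assigns A. sat A y (stage t) \<and> (\<forall>i<?k. True \<longrightarrow> y (cnth ?l i) = z i))" for z
  proof (rule sat_tie[OF univ_nonempty])
    show "fv_fm (stage t) \<subseteq> {..<Suc (t + ?l)}" using fv_stage[of t] by auto
    show "cnth ?l i < Suc (t + ?l)" if "i < ?k" for i
      using member_less_list_encode[of "bs ! i" bs] that by (simp add: cnth_encode)
  qed
  have 2: "sat A (prepend ?k x (\<lambda>_. a0)) p \<longleftrightarrow> sat A (\<lambda>i. y (bs ! i)) p"
    if "\<forall>i<?k. y (bs ! i) = x i" for x y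
    by (rule sat_cong) (use assms that in \<open>auto simp: formulas_def prepend_def\<close>)
  have "compatible t p ?l \<longleftrightarrow> (\<exists>x\<in>assigns A. sat A (prepend ?k x (\<lambda>_. a0)) p \<and>
      (\<exists>y\<in>assigns A. sat A y (stage t) \<and> (\<forall>i<?k. y (bs ! i) = x i)))"
    unfolding compatible_def sat_Exs[OF univ_nonempty] sat_And clen_encode 1
    by (auto simp: cnth_encode prepend_def)
  also have "\<dots> \<longleftrightarrow> (\<exists>y\<in>assigns A. sat A y (stage t) \<and> sat A (\<lambda>i. y (bs ! i)) p)"
  proof
    assume "\<exists>y\<in>assigns A. sat A y (stage t) \<and> sat A (\<lambda>i. y (bs ! i)) p"
    then obtain y where y: "y \<in> assigns A" "sat A y (stage t)" "sat A (\<lambda>i. y (bs ! i)) p" by blast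
    moreover from y(1) have "(\<lambda>i. y (bs ! i)) \<in> assigns A" by (auto simp: assigns_def)
    moreover have "sat A (prepend ?k (\<lambda>i. y (bs ! i)) (\<lambda>_. a0)) p" using y(3) by (subst 2) auto
    ultimately show "\<exists>x\<in>assigns A. sat A (prepend ?k x (\<lambda>_. a0)) p \<and>
      (\<exists>y\<in>assigns A. sat A y (stage t) \<and> (\<forall>i<?k. y (bs ! i) = x i))" by blast
  qed (use 2 in blast)
  finally show ?thesis .
qed

lemma computable_pred_compatible:
  assumes "computable t" "computable (\<lambda>x. fm_code (p x))" "computable l" "\<And>x. wf_fm L (p x)"
  shows "computable_pred (\<lambda>x. compatible (t x) (p x) (l x))"
  unfolding compatible_def
  by (intro computable_pred_sat computable_intros assms assms(1-3)[THEN computable_comp_pfst])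
    (simp_all add: assms a0_in)

definition true_at :: "nat \<Rightarrow> nat \<Rightarrow> bool" where
  "true_at j l \<longleftrightarrow> j \<in> fm_code ` formulas L (clen l) \<and> forced (\<lambda>y. sat A (\<lambda>i. y (list_decode l ! i)) (sigma j))"

text \<open>Every formula is decided at some stage. Search for the first stage incompatible with the
  formula or with its negation, then test the formula there.\<close>

lemma computable_pred_true_at [computable_intros]:
  assumes "computable j" "computable l"
  shows "computable_pred (\<lambda>x. true_at (j x) (l x))"
proof -
  define ok where "ok z \<longleftrightarrow> pfst z \<in> fm_code ` formulas L (clen (psnd z))" for z
  \<comment> \<open>Numbers that code no suitable formula satisfy this vacuously, so the search is
    total.\<close>
  define dec where "dec z t \<longleftrightarrow> (ok z \<longrightarrow> \<not> compatible t (sigma (pfst z)) (psnd z) \<or>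
      \<not> compatible t (Neg (sigma (pfst z))) (psnd z))" for z t
  have comp: "compatible t (sigma (pfst z)) (psnd z) \<longleftrightarrow>
      (\<exists>y\<in>assigns A. sat A y (stage t) \<and> sat A (\<lambda>i. y (list_decode (psnd z) ! i)) (sigma (pfst z)))"
    "compatible t (Neg (sigma (pfst z))) (psnd z) \<longleftrightarrow>
      (\<exists>y\<in>assigns A. sat A y (stage t) \<and> \<not> sat A (\<lambda>i. y (list_decode (psnd z) ! i)) (sigma (pfst z)))"
    if "ok z" for z t
  proof -
    from that obtain p where p: "p \<in> formulas L (clen (psnd z))" "pfst z = fm_code p"
      by (auto simp: ok_def)
    then have "sigma (pfst z) \<in> formulas L (length (list_decode (psnd z)))"
      using clen_encode[of "list_decode (psnd z)"] by (simp add: sigma_fm_code)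
    then show "compatible t (sigma (pfst z)) (psnd z) \<longleftrightarrow>
      (\<exists>y\<in>assigns A. sat A y (stage t) \<and> sat A (\<lambda>i. y (list_decode (psnd z) ! i)) (sigma (pfst z)))"
    "compatible t (Neg (sigma (pfst z))) (psnd z) \<longleftrightarrow>
      (\<exists>y\<in>assigns A. sat A y (stage t) \<and> \<not> sat A (\<lambda>i. y (list_decode (psnd z) ! i)) (sigma (pfst z)))"
      using compatible_encode[of "sigma (pfst z)" "list_decode (psnd z)"]
        compatible_encode[of "Neg (sigma (pfst z))" "list_decode (psnd z)"] by (auto simp: formulas_def)
  qed
  have ex: "\<exists>t. dec z t" for z
  proof (cases "ok z")
    case True
    have "forced (\<lambda>y. sat A (\<lambda>i. y (list_decode (psnd z) ! i)) (sigma (pfst z))) \<or>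
      forced (\<lambda>y. \<not> sat A (\<lambda>i. y (list_decode (psnd z) ! i)) (sigma (pfst z)))"
      using forced_not_iff[of "sigma (pfst z)"] by auto
    then show ?thesis unfolding dec_def using comp[OF True] unfolding forced_def by blast
  qed (simp add: dec_def)
  have true_iff: "true_at (pfst z) (psnd z) \<longleftrightarrow>
      ok z \<and> compatible (LEAST t. dec z t) (sigma (pfst z)) (psnd z)" for z
  proof (cases "ok z")
    case True
    define t where "t = (LEAST t. dec z t)"
    have "dec z t" unfolding t_def using ex by (rule LeastI_ex)
    moreover obtain y where "y \<in> assigns A" "sat A y (stage t)" using realized_stage by (auto simp: realized_def)
    ultimately have
      "forced (\<lambda>y. sat A (\<lambda>i. y (list_decode (psnd z) ! i)) (sigma (pfst z))) \<longleftrightarrow> compatible t (sigma (pfst z)) (psnd z)"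
      using forced_not_iff[of "sigma (pfst z)" "\<lambda>i. list_decode (psnd z) ! i"] True
      unfolding dec_def comp[OF True] forced_def by (metis wf_sigma)
    with True show ?thesis by (simp add: true_at_def ok_def t_def)
  qed (simp add: true_at_def ok_def)
  have "computable (\<lambda>z. LEAST t. dec z t)"
    using ex unfolding dec_def ok_def
    by (intro computable_intros computable_pred_compatible) simp_all
  then have "computable_pred (\<lambda>z. ok z \<and> compatible (LEAST t. dec z t) (sigma (pfst z)) (psnd z))"
    unfolding ok_def
    by (intro computable_pred_conj computable_pred_compatible computable_pred_code_of_formula
        computable_clen computable_code_sigma computable_pfst computable_psnd computable_id) simp_all
  then have "computable_pred (\<lambda>z. true_at (pfst z) (psnd z))" by (simp only: true_iff)
  then show ?thesis by (rule computable_pred_comp2) (rule assms)+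
qed

lemma computable_pred_univ_model [computable_intros]:
  assumes "computable f" shows "computable_pred (\<lambda>x. f x \<in> univ model)"
proof -
  let ?j = "fm_code (Eq (Var 0) (Var 1))"
  \<comment> \<open>The list is \<open>[m, n]\<close>, in the shape required by the computability
    rule for codes of mapped lists.\<close>
  have eq: "forced (\<lambda>y. y m = y n) \<longleftrightarrow> true_at ?j (list_encode (map (case_nat m (\<lambda>_. n)) [0..<2]))" for m n
  proof -
    have "Eq (Var 0) (Var 1) \<in> formulas L 2" by (auto simp: formulas_def)
    moreover from this have "sigma ?j = Eq (Var 0) (Var 1)" by (rule sigma_fm_code)
    ultimately show ?thesis unfolding true_at_def clen_encode by (simp del: fm_code.simps)
  qed
  have "computable_pred (\<lambda>n. n \<in> univ model)"
    unfolding in_univ_model eq by (intro computable_intros)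
  then show ?thesis using assms by (rule computable_pred_comp)
qed

lemma decidable_structure_model: "decidable_structure L model"
proof -
  let ?D = "(\<lambda>(p, as). prod_encode (fm_code p, list_encode as)) ` elementary_diagram L model"
  have "n \<in> ?D \<longleftrightarrow> true_at (pfst n) (psnd n) \<and> (\<forall>i<clen (psnd n). cnth (psnd n) i \<in> univ model)" for n
  proof -
    obtain bs where bs: "psnd n = list_encode bs" by (metis list_decode_inverse)
    have univ: "(\<forall>i<clen (psnd n). cnth (psnd n) i \<in> univ model) \<longleftrightarrow> set bs \<subseteq> univ model"
      unfolding bs clen_encode by (auto simp: cnth_encode set_conv_nth)
    have "n \<in> ?D \<longleftrightarrow> (\<exists>p. pfst n = fm_code p \<and> (p, bs) \<in> elementary_diagram L model)"
    proof
      assume "n \<in> ?D"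
      then obtain p as where "n = prod_encode (fm_code p, list_encode as)" "(p, as) \<in> elementary_diagram L model"
        by auto
      with bs show "\<exists>p. pfst n = fm_code p \<and> (p, bs) \<in> elementary_diagram L model"
        by (auto simp: list_encode_eq)
    next
      assume "\<exists>p. pfst n = fm_code p \<and> (p, bs) \<in> elementary_diagram L model"
      then obtain p where "pfst n = fm_code p" "(p, bs) \<in> elementary_diagram L model" by blast
      then show "n \<in> ?D" using bs prod_encode_pfst_psnd[of n] by force
    qed
    also have "\<dots> \<longleftrightarrow> true_at (pfst n) (psnd n) \<and> set bs \<subseteq> univ model"
      unfolding true_at_def bs clen_encode elementary_diagram_def
      by (auto simp: holds_model sigma_fm_code)
    finally show ?thesis unfolding univ .
  qed
  then have "computable_pred (\<lambda>n. n \<in> ?D)" by (simp only:) (intro computable_intros)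
  then show ?thesis by (simp add: decidable_structure_def computable_set_def computable_pred_def)
qed

subsection \<open>Computable embeddings\<close>

text \<open>Completeness of \<open>T\<close> stands in for the completeness theorem:
  \<open>T\<close> proves or refutes the universal closure, and a refutation would contradict
  soundness in \<open>A\<close>.\<close>

lemma derives_iff_valid:
  assumes "p \<in> formulas L k"
  shows "derives L T p \<longleftrightarrow> (\<forall>y\<in>assigns A. sat A y p)"
proof
  assume "derives L T p"
  then show "\<forall>y\<in>assigns A. sat A y p"
    using soundness[OF is_model] complete_theory by (auto simp: complete_theory_def)
next
  assume valid: "\<forall>y\<in>assigns A. sat A y p"
  have "Alls k p \<in> sentences L" using assms by (auto simp: formulas_def)
  then consider "derives L T (Alls k p)" | "derives L T (Neg (Alls k p))"
    using complete_theory by (auto simp: complete_theory_def)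
  then show "derives L T p"
  proof cases
    case 1
    with derives_Alls_iff[OF assms] show ?thesis by simp
  next
    case 2
    have y: "(\<lambda>_. a0) \<in> assigns A" using a0_in by (simp add: assigns_def)
    have "prepend k x (\<lambda>_. a0) \<in> assigns A" if "x \<in> assigns A" for x
      using that a0_in by (auto simp: assigns_def prepend_def)
    with valid have "sat A (\<lambda>_. a0) (Alls k p)" by (simp add: sat_Alls[OF univ_nonempty])
    moreover have "sat A (\<lambda>_. a0) (Neg (Alls k p))"
      using soundness[OF is_model _ 2 y] complete_theory by (simp add: complete_theory_def)
    ultimately show ?thesis by simp
  qed
qed

theorem effectively_atomic_if_embedding:
  assumes "computable f" and emb: "elementary_embedding L A model f"
  shows "\<exists>h. witnesses_effectively_atomic L T A h"
proof -
  obtain e where e: "\<And>x y. f x = y \<longleftrightarrow> (\<exists>c. certifies c e x y)"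
    using enumeration[OF assms(1)] by blast
  have f_univ: "f a \<in> univ model" if "a \<in> univ A" for a
    using emb that by (auto simp: elementary_embedding_def)
  have f_holds: "holds A p as \<longleftrightarrow> holds model p (map f as)"
    if "set as \<subseteq> univ A" "p \<in> formulas L (length as)" for p as
    using emb that by (auto simp: elementary_embedding_def)
  have conv_f: "psnd p = f (pfst p)" "pfst p \<in> univ A" if "conv e s p" for s p
    using that e[of "pfst p" "psnd p"] by (auto simp: conv_def)
  \<comment> \<open>The model satisfies \<open>stage t\<close> under \<open>rep\<close>, hence its
    projection to the known values of \<open>f\<close>. The embedding pulls this back to the
    arguments in \<open>A\<close>; as \<open>?p\<close> uses the arguments as indices, the tuple
    \<open>?as\<close> has \<open>param a\<close> at position \<open>a\<close>.\<close>
  have realizes: "\<exists>y\<in>assigns A. sat A y (stage t) \<and> matches e t y" for t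
  proof -
    let ?p = "tie (Suc t) (stage t) t (conv e t) psnd pfst" and ?as = "map param [0..<t]"
    have "fv_fm ?p \<subseteq> pfst ` {i. i < t \<and> conv e t i}"
      by (rule fv_tie[OF fv_stage psnd_less_Suc]) auto
    also have "\<dots> \<subseteq> {..<t}" using pfst_le le_less_trans by blast
    finally have p: "?p \<in> formulas L (length ?as)" by (simp add: formulas_def)
    have sat_p: "sat B z ?p \<longleftrightarrow> (\<exists>y\<in>assigns B. sat B y (stage t) \<and>
        (\<forall>q<t. conv e t q \<longrightarrow> y (psnd q) = z (pfst q)))" if "univ B \<noteq> {}" for B :: "nat struct" and z
      using that fv_stage psnd_less_Suc by (intro sat_tie)
    have nonempty: "univ model \<noteq> {}" using rep_in_univ by blast
    have "holds model ?p (map f ?as)"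
      unfolding holds_def sat_p[OF nonempty]
    proof (intro bexI[of _ rep] conjI allI impI)
      show "sat model rep (stage t)" using sat_model[of "stage t" "\<lambda>i. i"] by (auto simp: forced_def)
      show "rep (psnd q) = map f ?as ! pfst q" if "q < t" "conv e t q" for q
        using conv_f[OF that(2)] f_univ pfst_le[of q] that(1) by (simp add: rep_eq param_def)
      show "rep \<in> assigns model" using rep_in_univ by (simp add: assigns_def)
    qed
    then have "holds A ?p ?as" using f_holds[of ?as ?p] p param_in by auto
    then obtain y where y: "y \<in> assigns A" "sat A y (stage t)"
      "\<forall>q<t. conv e t q \<longrightarrow> y (psnd q) = ?as ! pfst q"
      unfolding holds_def sat_p[OF univ_nonempty] by blast
    have "matches e t y" unfolding matches_def
    proof (intro allI impI)
      fix q assume q: "q < t" "conv e t q"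
      with y(3) conv_f(2)[OF q(2)] pfst_le[of q] show "y (psnd q) = pfst q" by (simp add: param_def)
    qed
    with y show ?thesis by blast
  qed
  from eventually_no_strengthening[OF this] obtain s0 where
    s0: "\<And>t y. s0 \<le> t \<Longrightarrow> y \<in> assigns A \<Longrightarrow> sat A y (stage t) \<Longrightarrow>
      \<exists>y'\<in>assigns A. sat A y' (stage (Suc t)) \<and> (\<forall>p<t. conv e t p \<longrightarrow> y' (psnd p) = y (psnd p))"
    by blast
  \<comment> \<open>Iterating the previous fact keeps the constants known at stage \<open>s\<close>
    fixed through all later stages.\<close>
  have extend: "\<exists>y'\<in>assigns A. sat A y' (stage t) \<and> (\<forall>p<s. conv e s p \<longrightarrow> y' (psnd p) = y (psnd p))"
    if "s \<le> t" "s0 \<le> s" "y \<in> assigns A" "sat A y (stage s)" for s t y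
    using that(1)
  proof (induction rule: dec_induct)
    case base
    then show ?case using that by blast
  next
    case (step t)
    then obtain y1 where y1: "y1 \<in> assigns A" "sat A y1 (stage t)"
      "\<forall>p<s. conv e s p \<longrightarrow> y1 (psnd p) = y (psnd p)" by blast
    from s0[OF _ y1(1,2)] step that(2) obtain y2 where y2: "y2 \<in> assigns A" "sat A y2 (stage (Suc t))"
      "\<forall>p<t. conv e t p \<longrightarrow> y2 (psnd p) = y1 (psnd p)" by auto
    have "y2 (psnd p) = y (psnd p)" if "p < s" "conv e s p" for p
      using y1(3) y2(3) that step conv_mono[of s t e p] by simp
    with y2 show ?case by blast
  qed

  \<comment> \<open>A stage after \<open>s0\<close> at which all values of \<open>f\<close> on the
    tuple are known: their certificates, and the pairs that code their place in the graph, lie below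
    it.\<close>
  define good where "good l s \<longleftrightarrow> s0 \<le> s \<and> (\<forall>i<clen l. prod_encode (cnth l i, f (cnth l i)) < s \<and>
      (\<exists>c<s. certifies c e (cnth l i) (f (cnth l i))))" for l s
  have "\<exists>s. good l s" for l
  proof -
    have "\<exists>b. \<forall>s\<ge>b. prod_encode (a, f a) < s \<and> (\<exists>c<s. certifies c e a (f a))" for a
    proof -
      obtain c where c: "certifies c e a (f a)" using e by blast
      then show ?thesis
        by (intro exI[of _ "Suc (prod_encode (a, f a) + c)"]) (auto intro!: exI[of _ c])
    qed
    from eventually_bounded_ball[of "\<lambda>i s. prod_encode (cnth l i, f (cnth l i)) < s \<and>
      (\<exists>c<s. certifies c e (cnth l i) (f (cnth l i)))", OF this]
    obtain b where "\<forall>s\<ge>b. \<forall>i<clen l. prod_encode (cnth l i, f (cnth l i)) < s \<and>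
      (\<exists>c<s. certifies c e (cnth l i) (f (cnth l i)))" by blast
    then show ?thesis by (intro exI[of _ "max s0 b"]) (auto simp: good_def)
  qed
  note good_ex = this
  define st where "st l = (LEAST s. good l s)" for l
  have good_st: "good l (st l)" for l unfolding st_def using good_ex by (rule LeastI_ex)
  define g where "g l = tie (Suc (st l)) (stage (st l)) (clen l) (\<lambda>_. True) (\<lambda>i. f (cnth l i)) (\<lambda>i. i)" for l
  define h where "h as = g (list_encode as)" for as
  have "computable st"
    unfolding st_def using good_ex unfolding good_def
    by (intro computable_intros computable_comp[OF assms(1)])
  then have "computable (\<lambda>l. fm_code (g l))"
    unfolding g_def by (intro computable_intros computable_comp[OF assms(1)])
  then have "computable_via list_encode fm_code h"
    by (auto simp: computable_via_def h_def)
  moreover have "complete_formula L T (length as) (h as) \<and> holds A (h as) as" if as: "set as \<subseteq> univ A" for as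
  proof -
    let ?k = "length as" and ?s = "st (list_encode as)"
    have good: "s0 \<le> ?s" "\<And>i. i < ?k \<Longrightarrow> prod_encode (as ! i, f (as ! i)) < ?s"
      "\<And>i. i < ?k \<Longrightarrow> \<exists>c<?s. certifies c e (as ! i) (f (as ! i))"
      using good_st[of "list_encode as"] by (auto simp: good_def clen_encode cnth_encode)
    have conv: "conv e ?s (prod_encode (as ! i, f (as ! i)))" if "i < ?k" for i
      using good(3)[OF that] as that by (auto simp: conv_def)
    have bound: "f (cnth (list_encode as) i) < Suc ?s" if "i < ?k" for i
      using psnd_less_Suc[OF good(2)[OF that]] that by (simp add: cnth_encode)
    have h_sat: "sat A z (h as) \<longleftrightarrow>
        (\<exists>y\<in>assigns A. sat A y (stage ?s) \<and> (\<forall>i<?k. y (f (as ! i)) = z i))" for z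
    proof -
      have "sat A z (h as) \<longleftrightarrow> (\<exists>y\<in>assigns A. sat A y (stage ?s) \<and>
          (\<forall>i<?k. True \<longrightarrow> y (f (cnth (list_encode as) i)) = z i))"
        unfolding h_def g_def clen_encode using univ_nonempty fv_stage bound by (intro sat_tie)
      then show ?thesis by (simp add: cnth_encode cong: conj_cong)
    qed
    have "fv_fm (h as) \<subseteq> (\<lambda>i. i) ` {i. i < ?k \<and> True}"
      unfolding h_def g_def clen_encode using fv_stage bound by (intro fv_tie) auto
    then have h: "h as \<in> formulas L ?k" by (auto simp: formulas_def h_def g_def)
    obtain y where y: "y \<in> assigns A" "sat A y (stage ?s)" "matches e ?s y" using realizes by blast
    have "y (f (as ! i)) = as ! i" if "i < ?k" for i
      using y(3)[unfolded matches_def, rule_format, OF good(2)[OF that] conv[OF that]] by simp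
    with y h_sat have h_as: "holds A (h as) as" unfolding holds_def by blast
    \<comment> \<open>Since \<open>f\<close> is elementary, some stage forces \<open>q\<close> at
      the images of \<open>as\<close>. An assignment for \<open>stage ?s\<close> moves to that stage
      without changing the images, so \<open>q\<close> already holds for it.\<close>
    have implies: "derives L T (Imp (h as) q)" if q: "q \<in> formulas L ?k" and "holds A q as" for q
    proof -
      have model_q: "forced (\<lambda>y. sat A (\<lambda>i. y (map f as ! i)) q)"
        using f_holds[OF as q] \<open>holds A q as\<close> holds_model[of q "map f as"] q as f_univ by auto
      have "sat A z q" if "sat A z (h as)" for z
      proof -
        from that h_sat obtain y where y: "y \<in> assigns A" "sat A y (stage ?s)" "\<forall>i<?k. y (f (as ! i)) = z i" by blast
        from model_q obtain t where
          t: "\<And>y. y \<in> assigns A \<Longrightarrow> sat A y (stage t) \<Longrightarrow> sat A (\<lambda>i. y (map f as ! i)) q"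
          by (auto simp: forced_def)
        from extend[of ?s "max ?s t", OF _ good(1) y(1,2)] obtain y' where
          y': "y' \<in> assigns A" "sat A y' (stage (max ?s t))"
            "\<forall>p<?s. conv e ?s p \<longrightarrow> y' (psnd p) = y (psnd p)" by auto
        have "y' (f (as ! i)) = z i" if "i < ?k" for i
          using y'(3)[rule_format, OF good(2)[OF that] conv[OF that]] y(3) that by simp
        then have "sat A (\<lambda>i. y' (map f as ! i)) q \<longleftrightarrow> sat A z q"
          using q by (intro sat_cong) (auto simp: formulas_def subset_eq)
        with t[OF y'(1)] stage_mono[OF _ y'(2), of t] show ?thesis by simp
      qed
      moreover have "Imp (h as) q \<in> formulas L ?k" using h q by (auto simp: formulas_def)
      ultimately show ?thesis using derives_iff_valid[of "Imp (h as) q" ?k] by simp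
    qed
    have "derives L T (Imp (h as) q) \<noteq> derives L T (Imp (h as) (Neg q))" if q: "q \<in> formulas L ?k" for q
    proof -
      have neg: "Neg q \<in> formulas L ?k" and imp: "Imp (h as) q \<in> formulas L ?k" "Imp (h as) (Neg q) \<in> formulas L ?k"
        using q h by (auto simp: formulas_def)
      \<comment> \<open>The tuple, padded with \<open>a0\<close> to an assignment, satisfies
        \<open>h as\<close>; hence \<open>h as\<close> cannot imply both \<open>q\<close> and its
        negation.\<close>
      define z where "z i = (if i < ?k then as ! i else a0)" for i
      have z: "z \<in> assigns A" using as a0_in by (auto simp: z_def assigns_def)
      have "sat A z (h as)" using h_as h unfolding holds_def
        by (subst sat_cong[of _ z "nth as"]) (auto simp: formulas_def z_def)
      then have "\<not> (derives L T (Imp (h as) q) \<and> derives L T (Imp (h as) (Neg q)))"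
        using derives_iff_valid[OF imp(1)] derives_iff_valid[OF imp(2)] z by auto
      moreover have "derives L T (Imp (h as) q) \<or> derives L T (Imp (h as) (Neg q))"
        using implies[OF q] implies[OF neg] by (auto simp: holds_def)
      ultimately show ?thesis by blast
    qed
    with h h_as show ?thesis by (simp add: complete_formula_def)
  qed
  ultimately show ?thesis unfolding witnesses_effectively_atomic_def by blast
qed

end

theorem theorem1p13:
  fixes L :: lang and T :: "fm set" and A :: "nat struct"
  assumes "computable_language L"
    and "complete_theory L T"
    and "decidable_theory L T"
    and "is_model L A T"
    and "decidable_structure L A"
  shows "(\<exists>h. witnesses_effectively_atomic L T A h) \<or>
    (\<exists>M :: nat struct. is_model L M T \<and> decidable_structure L M \<and>
       \<not> (\<exists>f. computable f \<and> elementary_embedding L A M f))"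
proof -
  interpret decidable_model L T A using assms by unfold_locales
  \<comment> \<open>A computable embedding into \<open>model\<close> makes \<open>A\<close>
    effectively atomic; if there is none, \<open>model\<close> serves as \<open>M\<close>.\<close>
  show ?thesis using effectively_atomic_if_embedding is_model_model decidable_structure_model by blast
qed

end
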